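(* Let $p$ be an odd prime and $g\geq 1$, and let $\mu$ be the probability measure on $X^g$ defined below. For every finite abelian $p$-group $C$ with $d(C)=g$, the $\mu$-measure of the set of $g$-tuples $(r_1,\ldots,r_g)\in X^g$ such that $(F/N)^{\mathrm{ab}}\cong C$, where $N$ is the closed normal subgroup of $F$ generated by $r_1,\ldots,r_g$, equals the Cohen–Lenstra probability $$\frac{1}{|\mathrm{Aut}(C)|}\cdot\frac{1}{p^{g^2}}\prod_{k=1}^{g}(p^g-p^{g-k})^2.$$ That is, the push-forward of this measure to finite abelian $p$-groups of rank $g$ is the Cohen–Lenstra measure.
   Context: $F$ is the free pro-$p$ group on $x_1,\ldots,x_g$, $\sigma$ is the automorphism of $F$ with $\sigma(x_i)=x_i^{-1}$, $\Phi(F)$ is the closure of $[F,F]F^p$, and $X=\{t^{-1}\sigma(t)\mid t\in\Phi(F)\}$. The measure $\mu$ on $X^g$ is the push-forward of the normalized Haar measure on $\Phi(F)^g$ under $(t_1,\ldots,t_g)\mapsto(t_1^{-1}\sigma(t_1),\ldots,t_g^{-1}\sigma(t_g))$. $d(C)$ is the minimal number of generators of $C$. *)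

theory Defs
  imports
    "HOL-Probability.Probability_Measure"
    "HOL-Computational_Algebra.Primes"
    "HOL-Algebra.Coset"
    "HOL-Algebra.Bij"
    "HOL-Algebra.Generated_Groups"
    "HOL-Algebra.Product_Groups"
begin

section \<open>Topological groups and pro-p groups\<close>

definition topological_group :: "('a, 'm) monoid_scheme \<Rightarrow> 'a topology \<Rightarrow> bool" where
  "topological_group G T \<longleftrightarrow>
     group G \<and> topspace T = carrier G \<and>
     continuous_map (prod_topology T T) T (\<lambda>(a, b). a \<otimes>\<^bsub>G\<^esub> b) \<and>
     continuous_map T T (\<lambda>a. inv\<^bsub>G\<^esub> a)"

definition profinite_group :: "('a, 'm) monoid_scheme \<Rightarrow> 'a topology \<Rightarrow> bool" where
  "profinite_group G T \<longleftrightarrow>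
     topological_group G T \<and> compact_space T \<and> Hausdorff_space T \<and>
     (\<forall>U. openin T U \<and> \<one>\<^bsub>G\<^esub> \<in> U \<longrightarrow> (\<exists>H. subgroup H G \<and> openin T H \<and> H \<subseteq> U))"

definition pro_p_group :: "nat \<Rightarrow> ('a, 'm) monoid_scheme \<Rightarrow> 'a topology \<Rightarrow> bool" where
  "pro_p_group p G T \<longleftrightarrow>
     profinite_group G T \<and>
     (\<forall>N. N \<lhd> G \<and> openin T N \<longrightarrow> (\<exists>k. card (rcosets\<^bsub>G\<^esub> N) = p ^ k))"

text \<open>
  The universal property of the free pro-p group on a finite set of generators.  A quantifier
  inside a definition cannot range over all types, so the test groups have their elements in
  \<^typ>\<open>nat \<Rightarrow> nat\<close>.  This loses nothing: the image of the generators lies in a topologically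
  finitely generated closed subgroup, which embeds in a countable product of finite groups and
  hence is isomorphic to a pro-p group on a subset of \<^typ>\<open>nat \<Rightarrow> nat\<close>.
\<close>

definition free_pro_p_group ::
  "nat \<Rightarrow> ('a, 'm) monoid_scheme \<Rightarrow> 'a topology \<Rightarrow> 'i set \<Rightarrow> ('i \<Rightarrow> 'a) \<Rightarrow> bool" where
  "free_pro_p_group p F T I x \<longleftrightarrow>
     pro_p_group p F T \<and> finite I \<and> x \<in> I \<rightarrow> carrier F \<and>
     (\<forall>(H :: (nat \<Rightarrow> nat) monoid) S. \<forall>a \<in> I \<rightarrow> carrier H. pro_p_group p H S \<longrightarrow>
        (\<exists>!\<phi>. \<phi> \<in> extensional (carrier F) \<and> \<phi> \<in> hom F H \<and> continuous_map T S \<phi> \<and>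
               (\<forall>i\<in>I. \<phi> (x i) = a i)))"

definition Frattini :: "nat \<Rightarrow> ('a, 'm) monoid_scheme \<Rightarrow> 'a topology \<Rightarrow> 'a set" where
  "Frattini p G T =
     T closure_of (derived G (carrier G) <#>\<^bsub>G\<^esub>
                   generate G ((\<lambda>y. y [^]\<^bsub>G\<^esub> p) ` carrier G))"

definition closed_normal_closure :: "('a, 'm) monoid_scheme \<Rightarrow> 'a topology \<Rightarrow> 'a set \<Rightarrow> 'a set" where
  "closed_normal_closure G T R = \<Inter>{N. N \<lhd> G \<and> closedin T N \<and> R \<subseteq> N}"

definition quotient_topology ::
  "('a, 'm) monoid_scheme \<Rightarrow> 'a topology \<Rightarrow> 'a set \<Rightarrow> 'a set topology" where
  "quotient_topology G T N =
     topology (\<lambda>U. U \<subseteq> carrier (G Mod N) \<and> openin T {a \<in> topspace T. N #>\<^bsub>G\<^esub> a \<in> U})"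

lemma openin_quotient_topology:
  "openin (quotient_topology G T N) U \<longleftrightarrow>
     U \<subseteq> carrier (G Mod N) \<and> openin T {a \<in> topspace T. N #>\<^bsub>G\<^esub> a \<in> U}"
proof -
  have "istopology (\<lambda>U. U \<subseteq> carrier (G Mod N) \<and> openin T {a \<in> topspace T. N #>\<^bsub>G\<^esub> a \<in> U})"
    unfolding istopology_def
  proof (intro conjI allI impI, goal_cases)
    case (1 U V)
    then show ?case by blast
  next
    case (2 U V)
    have "{a \<in> topspace T. N #>\<^bsub>G\<^esub> a \<in> U \<inter> V} =
        {a \<in> topspace T. N #>\<^bsub>G\<^esub> a \<in> U} \<inter> {a \<in> topspace T. N #>\<^bsub>G\<^esub> a \<in> V}" by blast
    with 2 show ?case by (simp add: openin_Int)
  next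
    case (3 K)
    then show ?case by blast
  next
    case (4 K)
    have "{a \<in> topspace T. N #>\<^bsub>G\<^esub> a \<in> \<Union>K} =
        (\<Union>U\<in>K. {a \<in> topspace T. N #>\<^bsub>G\<^esub> a \<in> U})" by blast
    with 4 show ?case by auto
  qed
  then show ?thesis by (simp add: quotient_topology_def)
qed

text \<open>
  As usual for profinite groups, the abelianization is the quotient by the closure of the
  commutator subgroup.
\<close>

definition abelianization :: "('a, 'm) monoid_scheme \<Rightarrow> 'a topology \<Rightarrow> 'a set monoid" where
  "abelianization G T = G Mod (T closure_of (derived G (carrier G)))"

section \<open>Haar measure\<close>

definition borel_sigma :: "'a topology \<Rightarrow> 'a measure" where
  "borel_sigma T = sigma (topspace T) {U. openin T U}"

text \<open>
  Outer regularity is part of the notion of Haar measure; for a finite Borel measure on a compact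
  Hausdorff space it is equivalent to being a Radon measure.
\<close>

definition normalized_Haar_measure ::
  "('a, 'm) monoid_scheme \<Rightarrow> 'a topology \<Rightarrow> 'a measure \<Rightarrow> bool" where
  "normalized_Haar_measure G T M \<longleftrightarrow>
     prob_space M \<and> space M = carrier G \<and> sets M = sets (borel_sigma T) \<and>
     (\<forall>a\<in>carrier G. \<forall>A\<in>sets M. emeasure M (a <#\<^bsub>G\<^esub> A) = emeasure M A) \<and>
     (\<forall>A\<in>sets M. emeasure M A = (INF U\<in>{U. openin T U \<and> A \<subseteq> U}. emeasure M U))"

section \<open>The measure on tuples of relators\<close>

definition relator_set ::
  "nat \<Rightarrow> ('a, 'm) monoid_scheme \<Rightarrow> 'a topology \<Rightarrow> ('a \<Rightarrow> 'a) \<Rightarrow> 'a set" where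
  "relator_set p F T \<sigma> = {inv\<^bsub>F\<^esub> t \<otimes>\<^bsub>F\<^esub> \<sigma> t | t. t \<in> Frattini p F T}"

definition Frattini_power ::
  "nat \<Rightarrow> nat \<Rightarrow> 'a monoid \<Rightarrow> 'a topology \<Rightarrow> (nat \<Rightarrow> 'a) monoid" where
  "Frattini_power p g F T = product_group {1..g} (\<lambda>_. F\<lparr>carrier := Frattini p F T\<rparr>)"

definition Frattini_power_topology ::
  "nat \<Rightarrow> nat \<Rightarrow> 'a monoid \<Rightarrow> 'a topology \<Rightarrow> (nat \<Rightarrow> 'a) topology" where
  "Frattini_power_topology p g F T =
     product_topology (\<lambda>_. subtopology T (Frattini p F T)) {1..g}"

definition relator_measure ::
  "nat \<Rightarrow> nat \<Rightarrow> 'a monoid \<Rightarrow> 'a topology \<Rightarrow> ('a \<Rightarrow> 'a) \<Rightarrow> (nat \<Rightarrow> 'a) measure \<Rightarrow> (nat \<Rightarrow> 'a) measure" where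
  "relator_measure p g F T \<sigma> M =
     distr M (borel_sigma (product_topology (\<lambda>_. subtopology T (relator_set p F T \<sigma>)) {1..g}))
       (\<lambda>t. \<lambda>i\<in>{1..g}. inv\<^bsub>F\<^esub> (t i) \<otimes>\<^bsub>F\<^esub> \<sigma> (t i))"

definition presented_abelianization ::
  "('a, 'm) monoid_scheme \<Rightarrow> 'a topology \<Rightarrow> 'a set \<Rightarrow> 'a set set monoid" where
  "presented_abelianization F T R =
     (let N = closed_normal_closure F T R
      in abelianization (F Mod N) (quotient_topology F T N))"

section \<open>Finite groups\<close>

definition min_num_generators :: "('a, 'm) monoid_scheme \<Rightarrow> nat" where
  "min_num_generators G =
     (LEAST n. \<exists>S. S \<subseteq> carrier G \<and> finite S \<and> card S = n \<and> generate G S = carrier G)"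

end

theory Submission
  imports Defs "HOL-Algebra.FiniteProduct" "HOL-Algebra.SndIsomorphismGrp"
begin

text \<open>
  Let \<open>|C| = p ^ m\<close> and \<open>q = p ^ (m + 1)\<close>. Write \<open>H = (\<int>/q) ^ g\<close> and let \<open>\<phi> : F \<rightarrow> H\<close> send
  the generators to the standard basis. By Nakayama's lemma in the finite quotients of \<open>F\<close>, the
  abelianization of \<open>F/N\<close> is isomorphic to \<open>C\<close> iff \<open>H/\<langle>\<phi> r\<^sub>1, \<dots>, \<phi> r\<^sub>g\<rangle>\<close> is. Since \<open>\<sigma>\<close> acts
  as \<open>-1\<close> on \<open>H\<close>, \<open>\<phi>(t\<inverse> \<sigma>(t)) = -2 \<phi>(t)\<close>, and \<open>-2\<close> is a unit modulo \<open>q\<close>, so this only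
  depends on the images \<open>\<phi> t\<^sub>i\<close>, which are independent and uniform in \<open>pH = \<phi>(\<Phi>(F))\<close>.

  It remains to count the tuples \<open>v\<close> in \<open>H\<close> with \<open>H/\<langle>v\<rangle> \<cong> C\<close>. Such tuples lie in \<open>pH\<close>, and one
  counts pairs of an epimorphism \<open>s : H \<rightarrow> C\<close> and a generating \<open>g\<close>-tuple of \<open>ker s\<close> in two ways.
  Epimorphisms correspond to generating \<open>g\<close>-tuples of \<open>C\<close>; \<open>ker s\<close> contains \<open>p ^ m H = H[p]\<close>, so
  like \<open>C\<close> it has rank \<open>g\<close>; and an abelian p-group \<open>B\<close> of rank \<open>g\<close> has
  \<open>|pB| ^ g |GL\<^sub>g(p)|\<close> generating \<open>g\<close>-tuples. Each \<open>v\<close> is the second component of \<open>|Aut C|\<close> pairs.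
\<close>

text \<open>The exponent m + 1 in q, one more than what kills C, is used twice. An element of H of
  order p is a p^m-th power, so every homomorphism to C kills it; hence the kernel L of an
  epimorphism H -> C has all the p-torsion of H, and with it rank g. In the Nakayama step, for a
  finite abelian quotient B of F and in additive notation, the isomorphism at the level of H gives
  p^m B <= q B = p^(m+1) B, and this forces p^m B = 0; with q = p^m the inclusion would say nothing.

  The factor p^(g^2) arises because C, L and H all have index p^g over their p-th powers: |C| |L| =
  |H| turns into |pC| p^g |pL| = |pH|, which is then raised to the power g. Of the other factors,
  |pC|^g cancels against the number of epimorphisms, and |pH|^g is the number of equally likely
  image tuples, so the final value does not depend on q. One factor |GL_g(p)| comes from bases of
  C/pC, the other from bases of L/pL.\<close>

section \<open>Generating tuples of finite abelian p-groups\<close>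

lemma (in comm_group) subgroup_nat_pow_image:
  assumes "subgroup H G"
  shows "subgroup ((\<lambda>y. y [^] (n::nat)) ` H) G"
proof (rule subgroupI)
  have sub: "H \<subseteq> carrier G" using assms by (rule subgroup.subset)
  then show "(\<lambda>y. y [^] n) ` H \<subseteq> carrier G" by auto
  show "(\<lambda>y. y [^] n) ` H \<noteq> {}" using subgroup.one_closed[OF assms] by auto
  fix a assume "a \<in> (\<lambda>y. y [^] n) ` H"
  then obtain y where y: "y \<in> H" "a = y [^] n" by auto
  then have "inv a = (inv y) [^] n" using sub by (auto simp: nat_pow_inv)
  then show "inv a \<in> (\<lambda>y. y [^] n) ` H" using y(1) subgroup.m_inv_closed[OF assms] by auto
  fix b assume "b \<in> (\<lambda>y. y [^] n) ` H"
  then obtain z where z: "z \<in> H" "b = z [^] n" by auto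
  then have "a \<otimes> b = (y \<otimes> z) [^] n" using y sub by (auto simp: nat_pow_distrib subsetD)
  then show "a \<otimes> b \<in> (\<lambda>y. y [^] n) ` H" using y(1) z(1) subgroup.m_closed[OF assms] by auto
qed

lemma (in group) subgroup_nat_pow_closed:
  assumes "subgroup H G" "h \<in> H" shows "h [^] (k :: nat) \<in> H"
  using subgroup_int_pow_closed[OF assms, of "int k"] by (simp add: int_pow_int)

lemma (in group) generate_insert_generate:
  assumes "S \<subseteq> carrier G" "v \<in> carrier G"
  shows "generate G (insert v (generate G S)) = generate G (insert v S)"
proof
  have sg: "subgroup (generate G (insert v S)) G" using assms by (intro generate_is_subgroup) auto
  have "generate G S \<subseteq> generate G (insert v S)" by (rule mono_generate) auto
  then show "generate G (insert v (generate G S)) \<subseteq> generate G (insert v S)"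
    using sg by (intro generate_subgroup_incl) (auto intro: generate.incl)
  show "generate G (insert v S) \<subseteq> generate G (insert v (generate G S))"
    by (rule mono_generate) (auto intro: generate.incl)
qed

lemma (in comm_group) generate_insert_subgroup:
  fixes p :: nat
  assumes W: "subgroup W G" and v: "v \<in> carrier G" and vp: "v [^] p \<in> W" and p: "0 < p"
  shows "generate G (insert v W) = (\<lambda>(i, w). v [^] i \<otimes> w) ` ({..<p} \<times> W)"
proof
  let ?E = "(\<lambda>(i, w). v [^] i \<otimes> w) ` ({..<p} \<times> W)"
  have Wc: "W \<subseteq> carrier G" using W by (rule subgroup.subset)
  have E: "v [^] n \<otimes> w \<in> ?E" if "w \<in> W" for n :: nat and w
  proof -
    have "v [^] n = v [^] (n mod p) \<otimes> (v [^] p) [^] (n div p)"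
      using v by (simp add: nat_pow_pow nat_pow_mult)
    then have "v [^] n \<otimes> w = v [^] (n mod p) \<otimes> ((v [^] p) [^] (n div p) \<otimes> w)"
      using v that Wc by (simp add: m_assoc subsetD)
    moreover have "(v [^] p) [^] (n div p) \<otimes> w \<in> W"
      using subgroup_nat_pow_closed[OF W vp] that subgroup.m_closed[OF W] by blast
    ultimately show ?thesis using p by force
  qed
  have "subgroup ?E G"
  proof (rule subgroupI)
    show "?E \<subseteq> carrier G" using v Wc by auto
    show "?E \<noteq> {}" using p subgroup.one_closed[OF W] by auto
    fix a assume "a \<in> ?E"
    then obtain i :: nat and w where a: "a = v [^] i \<otimes> w" "w \<in> W" by auto
    \<comment> \<open>Only natural exponents occur in the set, so the inverse is written with the
      nonnegative exponent p * i - i; the correcting factor is a power of \<open>v [^] p\<close> and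
      lies in W.\<close>
    have "inv (v [^] i) = v [^] (p * i - i) \<otimes> inv ((v [^] p) [^] i)"
    proof -
      have "v [^] (p * i - i) \<otimes> v [^] i = (v [^] p) [^] i"
        using v p by (simp add: nat_pow_mult nat_pow_pow)
      then have "v [^] (p * i - i) = (v [^] p) [^] i \<otimes> inv (v [^] i)"
        using v by (metis inv_solve_right nat_pow_closed)
      then show ?thesis using v
        by (simp add: m_ac)
    qed
    then have "inv a = v [^] (p * i - i) \<otimes> (inv ((v [^] p) [^] i) \<otimes> inv w)"
      using a v Wc by (simp add: inv_mult m_assoc subsetD)
    moreover have "inv ((v [^] p) [^] i) \<otimes> inv w \<in> W"
      using subgroup_nat_pow_closed[OF W vp] a(2) subgroup.m_closed[OF W]
        subgroup.m_inv_closed[OF W] by blast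
    ultimately show "inv a \<in> ?E" using E by metis
    fix b assume "b \<in> ?E"
    then obtain j :: nat and w' where b: "b = v [^] j \<otimes> w'" "w' \<in> W" by auto
    have "a \<otimes> b = v [^] (i + j) \<otimes> (w \<otimes> w')"
      using a b v Wc by (simp add: nat_pow_mult[symmetric] m_ac subsetD)
    then show "a \<otimes> b \<in> ?E" using E a(2) b(2) subgroup.m_closed[OF W] by metis
  qed
  moreover have "insert v W \<subseteq> ?E"
  proof -
    have "v \<in> ?E" using E[OF subgroup.one_closed[OF W], of 1] v by simp
    moreover have "w \<in> ?E" if "w \<in> W" for w using E[OF that, of 0] that Wc by (simp add: subsetD)
    ultimately show ?thesis by blast
  qed
  ultimately show "generate G (insert v W) \<subseteq> ?E" by (metis generate_subgroup_incl)
  have sg: "subgroup (generate G (insert v W)) G" using v Wc by (intro generate_is_subgroup) auto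
  have "v [^] i \<otimes> w \<in> generate G (insert v W)" if "w \<in> W" for i :: nat and w
    by (intro subgroup.m_closed[OF sg] subgroup_nat_pow_closed[OF sg] generate.incl) (use that in auto)
  then show "?E \<subseteq> generate G (insert v W)" by auto
qed

lemma (in group) nat_pow_coprime_mem_subgroup:
  fixes p n :: nat
  assumes W: "subgroup W G" and v: "v \<in> carrier G" and "v [^] p \<in> W" "v [^] n \<in> W" "coprime p n"
  shows "v \<in> W"
proof -
  obtain a b where ab: "a * int p + b * int n = 1"
    using assms(5) by (metis bezout_int coprime_iff_gcd_eq_1 coprime_int_iff)
  have "v = v [^] (int p * a + int n * b)" using ab v by (simp add: mult.commute)
  also have "\<dots> = (v [^] p) [^] a \<otimes> (v [^] n) [^] b"
    using v by (simp add: int_pow_mult flip: int_pow_pow int_pow_int)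
  also have "\<dots> \<in> W"
    using subgroup_int_pow_closed[OF W] assms(3,4) subgroup.m_closed[OF W] by blast
  finally show ?thesis .
qed

text \<open>If two of the first p powers of v agree modulo W, then some \<open>v [^] n\<close> with
  0 < n < p lies in W; as p is prime, this together with \<open>v [^] p\<close> puts v itself into
  W. So for v outside W the p cosets are distinct.\<close>

lemma (in comm_group) card_generate_insert_subgroup:
  fixes p :: nat
  assumes W: "subgroup W G" and v: "v \<in> carrier G" and vp: "v [^] p \<in> W" and p: "prime p"
  shows "card (generate G (insert v W)) = (if v \<in> W then 1 else p) * card W"
proof (cases "v \<in> W")
  case True
  have "generate G (insert v W) = W"
    using generate_subgroup_incl[of "insert v W" W] True W generate.incl[of _ "insert v W" G] by blast
  then show ?thesis using True by simp
next
  case False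
  have Wc: "W \<subseteq> carrier G" using W by (rule subgroup.subset)
  have key: "i = j" if "v [^] i \<otimes> w = v [^] j \<otimes> w'" "i \<le> j" "j < p" "w \<in> W" "w' \<in> W"
    for i j :: nat and w w'
  proof (rule ccontr)
    assume "i \<noteq> j"
    then have "0 < j - i" "j - i < p" using that by auto
    then have "coprime p (j - i)"
      using p by (metis prime_imp_coprime nat_dvd_not_less)
    moreover have "v [^] j = v [^] i \<otimes> v [^] (j - i)" using that v by (simp add: nat_pow_mult)
    then have "v [^] i \<otimes> w = v [^] i \<otimes> (v [^] (j - i) \<otimes> w')"
      using that v Wc by (simp add: m_assoc subsetD)
    then have "w = v [^] (j - i) \<otimes> w'" using that v Wc
      by (metis Units_eq Units_l_cancel m_closed nat_pow_closed subsetD)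
    then have "v [^] (j - i) = w \<otimes> inv w'" using that v Wc
      by (metis inv_solve_right nat_pow_closed subsetD)
    then have "v [^] (j - i) \<in> W"
      using that subgroup.m_closed[OF W] subgroup.m_inv_closed[OF W] by metis
    ultimately show False using nat_pow_coprime_mem_subgroup[OF W v vp] False by blast
  qed
  have "inj_on (\<lambda>(i, w). v [^] i \<otimes> w) ({..<p} \<times> W)"
  proof (rule inj_onI)
    fix x y assume xy: "x \<in> {..<p} \<times> W" "y \<in> {..<p} \<times> W"
      "(\<lambda>(i, w). v [^] i \<otimes> w) x = (\<lambda>(i, w). v [^] i \<otimes> w) y"
    obtain i w j w' where [simp]: "x = (i, w)" "y = (j, w')" by (cases x, cases y)
    from xy have a: "i \<in> {..<p}" "w \<in> W" "j \<in> {..<p}" "w' \<in> W" and eq: "v [^] i \<otimes> w = v [^] j \<otimes> w'"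
      by auto
    then have "i = j" using key[of i w j w'] key[of j w' i w] by (cases "i \<le> j") auto
    moreover from this have "w = w'" using eq a v Wc by (metis Units_eq Units_l_cancel nat_pow_closed subsetD)
    ultimately show "x = y" by simp
  qed
  then have "card (generate G (insert v W)) = card ({..<p} \<times> W)"
    using generate_insert_subgroup[OF W v vp prime_gt_0_nat[OF p]] by (simp add: card_image)
  then show ?thesis using False by (simp add: card_cartesian_product)
qed

text \<open>Modulo W the group is elementary abelian, so each further entry multiplies the order by
  1 or p.\<close>

lemma (in comm_group) card_generate_tuple_le:
  fixes p :: nat
  assumes W: "subgroup W G" and p: "prime p" and pW: "\<And>v. v \<in> carrier G \<Longrightarrow> v [^] p \<in> W"
    and f: "f \<in> {1..n} \<rightarrow> carrier G"
  shows "card (generate G (W \<union> f ` {1..n})) \<le> p ^ n * card W"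
  using f
proof (induction n)
  case 0
  have "generate G W = W" using generate_subgroup_incl[OF subset_refl W] generate.incl[of _ W G] by blast
  then show ?case by simp
next
  case (Suc n)
  let ?S = "W \<union> f ` {1..n}"
  have f: "f \<in> {1..n} \<rightarrow> carrier G" "f (Suc n) \<in> carrier G" using Suc.prems by auto
  have S: "?S \<subseteq> carrier G" using f W subgroup.subset by blast
  have "W \<union> f ` {1..Suc n} = insert (f (Suc n)) ?S" by (auto simp: atLeastAtMostSuc_conv)
  then have "generate G (W \<union> f ` {1..Suc n}) = generate G (insert (f (Suc n)) (generate G ?S))"
    using generate_insert_generate[OF S f(2)] by simp
  also have "card \<dots> \<le> p * card (generate G ?S)"
    using card_generate_insert_subgroup[OF generate_is_subgroup[OF S] f(2) _ p]
      pW[OF f(2)] generate.incl[of _ ?S G] prime_gt_0_nat[OF p] by auto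
  also have "\<dots> \<le> p ^ Suc n * card W" using Suc.IH[OF f(1)] by (simp add: mult.assoc)
  finally show ?case .
qed

text \<open>Linear independence in the elementary abelian group G/W, expressed by orders alone: n
  entries are independent iff together with W they generate a subgroup of the largest possible
  order. The product is the usual count of bases, in which entry j + 1 avoids a span of
  \<open>p ^ j * card W\<close> elements.\<close>

lemma (in comm_group) card_independent_tuples:
  fixes p :: nat
  assumes fin: "finite (carrier G)" and W: "subgroup W G" and p: "prime p"
    and pW: "\<And>v. v \<in> carrier G \<Longrightarrow> v [^] p \<in> W"
  shows "card {f \<in> {1..n} \<rightarrow>\<^sub>E carrier G. card (generate G (W \<union> f ` {1..n})) = p ^ n * card W}
    = (\<Prod>j<n. card (carrier G) - p ^ j * card W)"
proof (induction n)
  case 0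
  have "generate G W = W" using generate_subgroup_incl[OF subset_refl W] generate.incl[of _ W G] by blast
  then have "{f \<in> {1..0::nat} \<rightarrow>\<^sub>E carrier G. card (generate G (W \<union> f ` {1..0})) = p ^ 0 * card W} = {\<lambda>_. undefined}"
    by simp
  then show ?case by simp
next
  case (Suc n)
  let ?D = "\<lambda>n. {f \<in> {1..n} \<rightarrow>\<^sub>E carrier G. card (generate G (W \<union> f ` {1..n})) = p ^ n * card W}"
  let ?B = "\<lambda>f. carrier G - generate G (W \<union> f ` {1..n})"
  have Wc: "W \<subseteq> carrier G" using W by (rule subgroup.subset)
  have p0: "0 < p" "1 < p" using p prime_gt_0_nat prime_gt_1_nat by auto
  have W0: "0 < card W" using W fin Wc subgroup.one_closed[OF W] by (metis card_gt_0_iff empty_iff finite_subset)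
  have sg: "subgroup (generate G (W \<union> f ` {1..n})) G" if "f \<in> {1..n} \<rightarrow> carrier G" for f
    using that Wc by (intro generate_is_subgroup) auto
  \<comment> \<open>The bound of \<open>card_generate_tuple_le\<close> leaves no slack: order
    p^(n+1) |W| is reached only if the first n entries already reach theirs and the last entry
    contributes a factor p.\<close>
  have step: "card (generate G (W \<union> f ` {1..Suc n})) = p ^ Suc n * card W \<longleftrightarrow>
      card (generate G (W \<union> f ` {1..n})) = p ^ n * card W \<and> f (Suc n) \<in> ?B f"
    if f: "f \<in> {1..Suc n} \<rightarrow> carrier G" for f
  proof -
    let ?S = "W \<union> f ` {1..n}"
    have f': "f \<in> {1..n} \<rightarrow> carrier G" "f (Suc n) \<in> carrier G" using f by auto
    have S: "?S \<subseteq> carrier G" using f' Wc by auto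
    have "W \<union> f ` {1..Suc n} = insert (f (Suc n)) ?S" by (auto simp: atLeastAtMostSuc_conv)
    then have "generate G (W \<union> f ` {1..Suc n}) = generate G (insert (f (Suc n)) (generate G ?S))"
      using generate_insert_generate[OF S f'(2)] by simp
    then have c: "card (generate G (W \<union> f ` {1..Suc n})) =
        (if f (Suc n) \<in> generate G ?S then 1 else p) * card (generate G ?S)"
      using card_generate_insert_subgroup[OF generate_is_subgroup[OF S] f'(2) _ p]
        pW[OF f'(2)] generate.incl[of _ ?S G] by auto
    have le: "card (generate G ?S) \<le> p ^ n * card W"
      by (rule card_generate_tuple_le[OF W p pW f'(1)])
    have "p ^ n * card W < p ^ Suc n * card W" using p0 W0 by simp
    with c le f'(2) p0 show ?thesis by (auto simp: mult.assoc)
  qed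
  \<comment> \<open>Tuples are extensional, so dropping the last entry must reset index
    \<open>Suc n\<close> to \<open>undefined\<close>; this is what \<open>restrict\<close> does in
    the inverse map.\<close>
  have "bij_betw (\<lambda>(f, v). f(Suc n := v)) (Sigma (?D n) ?B) (?D (Suc n))"
  proof (rule bij_betw_byWitness[where f' = "\<lambda>f. (restrict f {1..n}, f (Suc n))"])
    have "restrict (f(Suc n := v)) {1..n} = f" if "f \<in> {1..n} \<rightarrow>\<^sub>E carrier G" for f v
    proof
      show "restrict (f(Suc n := v)) {1..n} i = f i" for i
        using that by (cases "i \<in> {1..n}") (auto dest: PiE_arb)
    qed
    then show "\<forall>a\<in>Sigma (?D n) ?B. (\<lambda>f. (restrict f {1..n}, f (Suc n))) ((\<lambda>(f, v). f(Suc n := v)) a) = a"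
      by auto
    have "(restrict f {1..n})(Suc n := f (Suc n)) = f" if "f \<in> {1..Suc n} \<rightarrow>\<^sub>E carrier G" for f
    proof
      show "((restrict f {1..n})(Suc n := f (Suc n))) i = f i" for i
        using that PiE_arb[OF that, of i] by (cases "i \<in> {1..Suc n}") auto
    qed
    then show "\<forall>a\<in>?D (Suc n). (\<lambda>(f, v). f(Suc n := v)) (restrict a {1..n}, a (Suc n)) = a"
      by auto
    show "(\<lambda>(f, v). f(Suc n := v)) ` Sigma (?D n) ?B \<subseteq> ?D (Suc n)"
    proof clarify
      fix f v assume f: "f \<in> {1..n} \<rightarrow>\<^sub>E carrier G" and v: "v \<in> carrier G"
        "v \<notin> generate G (W \<union> f ` {1..n})"
        and c: "card (generate G (W \<union> f ` {1..n})) = p ^ n * card W"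
      have "f(Suc n := v) \<in> {1..Suc n} \<rightarrow>\<^sub>E carrier G"
        using f v by (auto simp: PiE_def extensional_def Pi_iff)
      moreover have "f(Suc n := v) ` {1..n} = f ` {1..n}" by auto
      ultimately show "f(Suc n := v) \<in> {1..Suc n} \<rightarrow>\<^sub>E carrier G \<and>
          card (generate G (W \<union> f(Suc n := v) ` {1..Suc n})) = p ^ Suc n * card W"
        using step[of "f(Suc n := v)"] v c by (auto simp: PiE_def)
    qed
    show "(\<lambda>f. (restrict f {1..n}, f (Suc n))) ` ?D (Suc n) \<subseteq> Sigma (?D n) ?B"
    proof clarify
      fix f assume f: "f \<in> {1..Suc n} \<rightarrow>\<^sub>E carrier G"
        and c: "card (generate G (W \<union> f ` {1..Suc n})) = p ^ Suc n * card W"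
      have "restrict f {1..n} ` {1..n} = f ` {1..n}" by auto
      then show "restrict f {1..n} \<in> ?D n \<and> f (Suc n) \<in> ?B (restrict f {1..n})"
        using step[of f] f c by (auto simp: PiE_def Pi_iff)
    qed
  qed
  then have "card (?D (Suc n)) = card (Sigma (?D n) ?B)" by (rule bij_betw_same_card[symmetric])
  also have "\<dots> = (\<Sum>f\<in>?D n. card (?B f))"
    by (intro card_SigmaI) (use fin in \<open>auto intro!: finite_PiE\<close>)
  also have "\<dots> = (\<Sum>f\<in>?D n. card (carrier G) - p ^ n * card W)"
  proof (intro sum.cong refl)
    fix f assume f: "f \<in> ?D n"
    then have "generate G (W \<union> f ` {1..n}) \<subseteq> carrier G"
      using sg[of f] subgroup.subset by (auto simp: PiE_def)
    with f fin show "card (?B f) = card (carrier G) - p ^ n * card W"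
      by (simp add: card_Diff_subset finite_subset)
  qed
  also have "\<dots> = (\<Prod>j<Suc n. card (carrier G) - p ^ j * card W)"
    using Suc.IH by (simp add: mult.commute)
  finally show ?case .
qed

text \<open>Nakayama's lemma, or the Burnside basis theorem, for abelian groups of exponent dividing
  p^k. Every a is s b^p with s generated by S; decomposing b in the same way again and again raises
  the exponent of the remainder to p^k, where it vanishes.\<close>

lemma (in comm_group) generate_eq_carrier_mod_powers:
  fixes p :: nat
  assumes exp: "\<And>a. a \<in> carrier G \<Longrightarrow> a [^] (p ^ k) = \<one>" and S: "S \<subseteq> carrier G"
    and gen: "generate G ((\<lambda>y. y [^] p) ` carrier G \<union> S) = carrier G"
  shows "generate G S = carrier G"
proof
  let ?W = "(\<lambda>y. y [^] p) ` carrier G"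
  have sg: "subgroup (generate G S) G" by (rule generate_is_subgroup[OF S])
  have sW: "subgroup ?W G" by (rule subgroup_nat_pow_image[OF subgroup_self])
  have "carrier G \<subseteq> generate G S <#> ?W"
  proof -
    have sub: "subgroup (generate G S <#> ?W) G" by (rule mult_subgroups[OF sg sW])
    have "?W \<union> S \<subseteq> generate G S <#> ?W"
    proof
      fix a assume a: "a \<in> ?W \<union> S"
      then have "a \<in> carrier G" using S by auto
      then have "a = \<one> \<otimes> a" "a = a \<otimes> \<one>" by auto
      then show "a \<in> generate G S <#> ?W"
        using a generate.incl[of a S G] generate.one[of G S] subgroup.one_closed[OF sW]
        unfolding set_mult_def by blast
    qed
    then show ?thesis using gen generate_subgroup_incl[OF _ sub] by blast
  qed
  then have one_step: "\<exists>s\<in>generate G S. \<exists>b\<in>carrier G. a = s \<otimes> b [^] p" if "a \<in> carrier G" for a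
    using that unfolding set_mult_def by blast
  have "\<exists>s\<in>generate G S. \<exists>b\<in>carrier G. a = s \<otimes> b [^] (p ^ j)" if "a \<in> carrier G" for a j
  proof (induction j)
    case 0
    then show ?case using that generate.one[of G S] by (intro bexI[of _ \<one>] bexI[of _ a]) auto
  next
    case (Suc j)
    then obtain s b where sb: "s \<in> generate G S" "b \<in> carrier G" "a = s \<otimes> b [^] (p ^ j)" by auto
    obtain t c where tc: "t \<in> generate G S" "c \<in> carrier G" "b = t \<otimes> c [^] p" using one_step[OF sb(2)] by auto
    have tcar: "t \<in> carrier G" "s \<in> carrier G" using tc(1) sb(1) generate_in_carrier[OF S] by auto
    then have "a = (s \<otimes> t [^] (p ^ j)) \<otimes> c [^] (p ^ Suc j)"
      using sb tc by (simp add: nat_pow_distrib nat_pow_pow m_assoc)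
    moreover have "s \<otimes> t [^] (p ^ j) \<in> generate G S"
      using sb(1) subgroup_nat_pow_closed[OF sg tc(1)] generate.eng by metis
    ultimately show ?case using tc(2) by blast
  qed
  then have "\<exists>s\<in>generate G S. \<exists>b\<in>carrier G. a = s \<otimes> b [^] (p ^ k)" if "a \<in> carrier G" for a
    using that by blast
  then show "carrier G \<subseteq> generate G S"
    using exp generate_in_carrier[OF S] by fastforce
  show "generate G S \<subseteq> carrier G" by (rule generate_incl[OF S])
qed

text \<open>By Nakayama, generating G means generating modulo p-th powers, and since that quotient
  has order p^n, an n-tuple does so iff it is independent there. The first factor counts the lifts
  of a basis, the product is |GL_n(p)|.\<close>

lemma (in comm_group) card_generating_tuples:
  fixes p :: nat
  assumes fin: "finite (carrier G)" and p: "prime p"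
    and exp: "\<And>a. a \<in> carrier G \<Longrightarrow> a [^] (p ^ k) = \<one>"
    and rank: "card (carrier G) = p ^ n * card ((\<lambda>y. y [^] p) ` carrier G)"
  shows "card {f \<in> {1..n} \<rightarrow>\<^sub>E carrier G. generate G (f ` {1..n}) = carrier G}
    = card ((\<lambda>y. y [^] p) ` carrier G) ^ n * (\<Prod>j<n. p ^ n - p ^ j)"
proof -
  let ?W = "(\<lambda>y. y [^] p) ` carrier G"
  have sW: "subgroup ?W G" by (rule subgroup_nat_pow_image[OF subgroup_self])
  have "{f \<in> {1..n} \<rightarrow>\<^sub>E carrier G. generate G (f ` {1..n}) = carrier G} =
    {f \<in> {1..n} \<rightarrow>\<^sub>E carrier G. card (generate G (?W \<union> f ` {1..n})) = p ^ n * card ?W}" (is "?A = ?B")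
  proof (intro Collect_cong conj_cong refl)
    fix f assume "f \<in> {1..n} \<rightarrow>\<^sub>E carrier G"
    then have S: "f ` {1..n} \<subseteq> carrier G" by auto
    then have sub: "generate G (?W \<union> f ` {1..n}) \<subseteq> carrier G"
      using sW subgroup.subset by (intro generate_incl) auto
    show "generate G (f ` {1..n}) = carrier G \<longleftrightarrow> card (generate G (?W \<union> f ` {1..n})) = p ^ n * card ?W"
    proof
      assume "generate G (f ` {1..n}) = carrier G"
      then have "generate G (?W \<union> f ` {1..n}) = carrier G"
        using sub mono_generate[of "f ` {1..n}" "?W \<union> f ` {1..n}"] by blast
      then show "card (generate G (?W \<union> f ` {1..n})) = p ^ n * card ?W" using rank by simp
    next
      assume "card (generate G (?W \<union> f ` {1..n})) = p ^ n * card ?W"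
      then have "generate G (?W \<union> f ` {1..n}) = carrier G"
        using rank sub fin by (metis card_subset_eq)
      then show "generate G (f ` {1..n}) = carrier G"
        using generate_eq_carrier_mod_powers[OF exp S] by blast
    qed
  qed
  then have "card ?A = (\<Prod>j<n. card (carrier G) - p ^ j * card ?W)"
    using card_independent_tuples[OF fin sW p, of n] by simp
  also have "\<dots> = (\<Prod>j<n. card ?W * (p ^ n - p ^ j))"
    using rank by (simp add: diff_mult_distrib mult.commute)
  also have "\<dots> = card ?W ^ n * (\<Prod>j<n. p ^ n - p ^ j)"
    by (simp add: prod.distrib)
  finally show ?thesis .
qed

text \<open>Let p^r be the index of the p-th powers. The count of generating r-tuples is positive,
  so such a tuple exists and n <= r; conversely n generators bound the index by p^n, so r <=
  n.\<close>

lemma (in comm_group) card_eq_rank_powers: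
  fixes p :: nat
  assumes fin: "finite (carrier G)" and p: "prime p" and ord: "order G = p ^ k"
    and d: "min_num_generators G = n"
  shows "card (carrier G) = p ^ n * card ((\<lambda>y. y [^] p) ` carrier G)"
proof -
  let ?W = "(\<lambda>y. y [^] p) ` carrier G"
  let ?P = "\<lambda>n. \<exists>S. S \<subseteq> carrier G \<and> finite S \<and> card S = n \<and> generate G S = carrier G"
  have sW: "subgroup ?W G" by (rule subgroup_nat_pow_image[OF subgroup_self])
  have exp: "a [^] (p ^ k) = \<one>" if "a \<in> carrier G" for a
    using that ord power_order_eq_one[OF fin that] by (simp add: order_def)
  have "generate G (carrier G) = carrier G"
    using generate_incl[of "carrier G"] generate.incl[of _ "carrier G" G] by blast
  then have "?P (card (carrier G))" using fin by blast
  then have "?P n" using d unfolding min_num_generators_def by (metis LeastI[of ?P])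
  then obtain S where S: "S \<subseteq> carrier G" "finite S" "card S = n" "generate G S = carrier G" by blast
  have min: "n \<le> j" if "?P j" for j using d that unfolding min_num_generators_def by (metis Least_le[of ?P])
  have "card (rcosets ?W) * card ?W = p ^ k" using lagrange[OF sW] ord by simp
  then obtain r where r: "card (rcosets ?W) = p ^ r"
    using p by (metis divides_primepow_nat dvd_triv_left)
  then have rk: "card (carrier G) = p ^ r * card ?W" using lagrange[OF sW] by (simp add: order_def)
  have W0: "0 < card ?W" using rk fin ord p by (auto simp: order_def card_gt_0_iff)
  have "0 < card ?W ^ r * (\<Prod>j<r. p ^ r - p ^ j)"
    using W0 p prime_gt_1_nat by (auto intro!: prod_pos power_strict_increasing)
  then have "card {f \<in> {1..r} \<rightarrow>\<^sub>E carrier G. generate G (f ` {1..r}) = carrier G} \<noteq> 0"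
    using card_generating_tuples[OF fin p exp rk] by linarith
  then obtain f where f: "f \<in> {1..r} \<rightarrow>\<^sub>E carrier G" "generate G (f ` {1..r}) = carrier G"
    by (metis (mono_tags, lifting) card.empty empty_Collect_eq)
  then have "n \<le> card (f ` {1..r})" by (intro min exI[of _ "f ` {1..r}"]) auto
  then have "n \<le> r" using card_image_le[of "{1..r}" f] by simp
  obtain h where h: "bij_betw h {1..n} S" using S ex_bij_betw_nat_finite_1 by blast
  then have hS: "h ` {1..n} = S" "h \<in> {1..n} \<rightarrow> carrier G" using S(1) by (auto simp: bij_betw_def)
  have "carrier G \<subseteq> generate G (?W \<union> S)" using S(4) mono_generate[of S "?W \<union> S"] by blast
  moreover have "generate G (?W \<union> S) \<subseteq> carrier G" using S(1) sW subgroup.subset by (intro generate_incl) auto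
  ultimately have "card (carrier G) \<le> p ^ n * card ?W"
    using card_generate_tuple_le[OF sW p _ hS(2)] hS(1) by auto
  then have "p ^ r \<le> p ^ n" using rk W0 by simp
  then have "r \<le> n" using p prime_gt_1_nat by (metis power_le_imp_le_exp)
  with \<open>n \<le> r\<close> rk show ?thesis by simp
qed

section \<open>Kernels and images of homomorphisms\<close>

lemma (in group_hom) card_kernel_image:
  assumes "finite (carrier G)"
  shows "card (carrier G) = card (h ` carrier G) * card (kernel G H h)"
proof -
  let ?I = "H\<lparr>carrier := h ` carrier G\<rparr>"
  interpret I: group ?I by (rule H.subgroup_imp_group[OF img_is_subgroup])
  interpret hI: group_hom G ?I h
    by (unfold_locales) (auto simp: hom_def)
  have "(G Mod kernel G ?I h) \<cong> ?I"
    by (rule hI.FactGroup_iso) auto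
  moreover have "kernel G ?I h = kernel G H h" by (simp add: kernel_def)
  ultimately have "card (rcosets kernel G H h) = card (h ` carrier G)"
    using iso_same_card by (fastforce simp: FactGroup_def)
  then show ?thesis using G.lagrange[OF subgroup_kernel] by (simp add: order_def)
qed

lemma (in group_hom) hom_eq_iff_kernel:
  assumes "a \<in> carrier G" "b \<in> carrier G"
  shows "h a = h b \<longleftrightarrow> a \<otimes> inv b \<in> kernel G H h"
proof -
  have "h a = h b \<longleftrightarrow> h a \<otimes>\<^bsub>H\<^esub> inv\<^bsub>H\<^esub> (h b) = h b \<otimes>\<^bsub>H\<^esub> inv\<^bsub>H\<^esub> (h b)"
    using assms by (subst H.right_cancel) auto
  then show ?thesis using assms by (simp add: kernel_def)
qed

lemma group_hom_eq_on_generate: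
  assumes "group_hom G H h" "group_hom G H k" and S: "S \<subseteq> carrier G" and "\<And>s. s \<in> S \<Longrightarrow> h s = k s"
    and a: "a \<in> generate G S"
  shows "h a = k a"
proof -
  interpret h: group_hom G H h by fact
  interpret k: group_hom G H k by fact
  show ?thesis using a
  proof induction
    case (eng a b)
    then show ?case using h.G.generate_in_carrier[OF S] by simp
  qed (use assms in \<open>auto simp: subsetD\<close>)
qed

subsection \<open>Homocyclic groups\<close>

text \<open>The group (Z/q)^g. Its elements have type \<open>nat \<Rightarrow> nat\<close>, the type
  of the test groups in \<open>free_pro_p_group\<close>, so the universal property of F applies to
  it without transport.\<close>

definition homocyclic :: "nat \<Rightarrow> nat \<Rightarrow> (nat \<Rightarrow> nat) monoid" where
  "homocyclic q g = \<lparr>carrier = {1..g} \<rightarrow>\<^sub>E {..<q},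
     monoid.mult = (\<lambda>a b. \<lambda>i\<in>{1..g}. (a i + b i) mod q), one = (\<lambda>i\<in>{1..g}. 0)\<rparr>"

text \<open>Standard basis vector; \<open>1 mod q\<close> keeps it inside the carrier when q = 1,
  where the entry must be 0.\<close>

definition hc_unit :: "nat \<Rightarrow> nat \<Rightarrow> nat \<Rightarrow> nat \<Rightarrow> nat" where
  "hc_unit q g i = (\<lambda>j\<in>{1..g}. if i = j then 1 mod q else 0)"

text \<open>For abelian A and y i killed by q, this is the homomorphism from (Z/q)^g that sends the
  i-th basis vector to y i: h serves as a vector of exponents.\<close>

definition hc_hom :: "nat \<Rightarrow> ('a, 'm) monoid_scheme \<Rightarrow> (nat \<Rightarrow> 'a) \<Rightarrow> (nat \<Rightarrow> nat) \<Rightarrow> 'a" where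
  "hc_hom g A y h = finprod A (\<lambda>i. y i [^]\<^bsub>A\<^esub> h i) {1..g}"

lemma carrier_homocyclic: "carrier (homocyclic q g) = {1..g} \<rightarrow>\<^sub>E {..<q}"
  and mult_homocyclic: "a \<otimes>\<^bsub>homocyclic q g\<^esub> b = (\<lambda>i\<in>{1..g}. (a i + b i) mod q)"
  and one_homocyclic: "\<one>\<^bsub>homocyclic q g\<^esub> = (\<lambda>i\<in>{1..g}. 0)"
  by (simp_all add: homocyclic_def)

lemmas homocyclic_simps = carrier_homocyclic mult_homocyclic one_homocyclic

lemma comm_group_homocyclic:
  assumes q: "0 < q"
  shows "comm_group (homocyclic q g)"
proof (rule comm_groupI)
  show "x \<otimes>\<^bsub>homocyclic q g\<^esub> y \<in> carrier (homocyclic q g)" for x y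
    using q by (auto simp: homocyclic_simps)
  show "\<one>\<^bsub>homocyclic q g\<^esub> \<in> carrier (homocyclic q g)" using q by (auto simp: homocyclic_simps)
  show "x \<otimes>\<^bsub>homocyclic q g\<^esub> y \<otimes>\<^bsub>homocyclic q g\<^esub> z =
      x \<otimes>\<^bsub>homocyclic q g\<^esub> (y \<otimes>\<^bsub>homocyclic q g\<^esub> z)" for x y z
    by (auto simp: homocyclic_simps fun_eq_iff mod_simps add.assoc)
  show "x \<otimes>\<^bsub>homocyclic q g\<^esub> y = y \<otimes>\<^bsub>homocyclic q g\<^esub> x" for x y
    by (auto simp: homocyclic_simps fun_eq_iff add.commute)
  show "\<one>\<^bsub>homocyclic q g\<^esub> \<otimes>\<^bsub>homocyclic q g\<^esub> x = x" if "x \<in> carrier (homocyclic q g)" for x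
    using that by (force simp: homocyclic_simps fun_eq_iff PiE_def extensional_def Pi_def)
  show "\<exists>y\<in>carrier (homocyclic q g). y \<otimes>\<^bsub>homocyclic q g\<^esub> x = \<one>\<^bsub>homocyclic q g\<^esub>"
    if "x \<in> carrier (homocyclic q g)" for x
  proof (rule bexI[of _ "\<lambda>i\<in>{1..g}. (q - x i) mod q"])
    have "x i < q" if "i \<in> {1..g}" for i using \<open>x \<in> _\<close> that by (auto simp: homocyclic_simps)
    then show "(\<lambda>i\<in>{1..g}. (q - x i) mod q) \<otimes>\<^bsub>homocyclic q g\<^esub> x = \<one>\<^bsub>homocyclic q g\<^esub>"
      by (auto simp: homocyclic_simps fun_eq_iff mod_simps less_imp_le)
    show "(\<lambda>i\<in>{1..g}. (q - x i) mod q) \<in> carrier (homocyclic q g)"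
      using q by (auto simp: homocyclic_simps)
  qed
qed

lemma finite_homocyclic: "finite (carrier (homocyclic q g))"
  by (simp add: carrier_homocyclic finite_PiE)

lemma card_homocyclic: "card (carrier (homocyclic q g)) = q ^ g"
  by (simp add: carrier_homocyclic card_PiE)

lemma pow_homocyclic:
  assumes "a \<in> carrier (homocyclic q g)"
  shows "a [^]\<^bsub>homocyclic q g\<^esub> (n::nat) = (\<lambda>i\<in>{1..g}. (n * a i) mod q)"
  by (induction n) (auto simp: homocyclic_simps fun_eq_iff mod_simps add.commute)

lemma pow_exponent_homocyclic:
  assumes "a \<in> carrier (homocyclic q g)"
  shows "a [^]\<^bsub>homocyclic q g\<^esub> q = \<one>\<^bsub>homocyclic q g\<^esub>"
  using pow_homocyclic[OF assms] by (auto simp: one_homocyclic)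

lemma hc_unit_closed:
  assumes "0 < q" shows "hc_unit q g i \<in> carrier (homocyclic q g)"
  using assms by (auto simp: hc_unit_def carrier_homocyclic)

lemma generate_hc_unit:
  assumes q: "0 < q"
  shows "generate (homocyclic q g) (hc_unit q g ` {1..g}) = carrier (homocyclic q g)"
proof
  let ?H = "homocyclic q g" and ?S = "hc_unit q g ` {1..g}"
  interpret H: comm_group ?H by (rule comm_group_homocyclic[OF q])
  have S: "?S \<subseteq> carrier ?H" using hc_unit_closed[OF q] by auto
  show "generate ?H ?S \<subseteq> carrier ?H" by (rule H.generate_incl[OF S])
  have sg: "subgroup (generate ?H ?S) ?H" by (rule H.generate_is_subgroup[OF S])
  show "carrier ?H \<subseteq> generate ?H ?S"
  proof
    fix h assume h: "h \<in> carrier ?H"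
    \<comment> \<open>Induction over truncations of h: one power of a basis vector adds the next
      coordinate, and the truncation at g is h.\<close>
    have "(\<lambda>j\<in>{1..g}. if j \<le> n then h j else 0) \<in> generate ?H ?S" if "n \<le> g" for n
      using that
    proof (induction n)
      case 0
      have "(\<lambda>j\<in>{1..g}. if j \<le> 0 then h j else 0) = \<one>\<^bsub>?H\<^esub>"
        by (auto simp: one_homocyclic fun_eq_iff)
      then show ?case using generate.one[of ?H ?S] by simp
    next
      case (Suc n)
      have hl: "h j < q" if "j \<in> {1..g}" for j using h that by (auto simp: carrier_homocyclic)
      have "(\<lambda>j\<in>{1..g}. if j \<le> Suc n then h j else 0) =
          (\<lambda>j\<in>{1..g}. if j \<le> n then h j else 0) \<otimes>\<^bsub>?H\<^esub> hc_unit q g (Suc n) [^]\<^bsub>?H\<^esub> h (Suc n)"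
        unfolding pow_homocyclic[OF hc_unit_closed[OF q]] mult_homocyclic
        using hl Suc.prems by (auto simp: fun_eq_iff hc_unit_def mod_simps le_Suc_eq)
      moreover have "hc_unit q g (Suc n) [^]\<^bsub>?H\<^esub> h (Suc n) \<in> generate ?H ?S"
        using Suc.prems by (intro H.subgroup_nat_pow_closed[OF sg] generate.incl) auto
      ultimately show ?case using generate.eng[OF Suc.IH[OF Suc_leD[OF Suc.prems]]] by metis
    qed
    moreover have "(\<lambda>j\<in>{1..g}. if j \<le> g then h j else 0) = h"
      using h by (auto simp: carrier_homocyclic PiE_def extensional_def restrict_def fun_eq_iff)
    ultimately show "h \<in> generate ?H ?S" by (metis order_refl)
  qed
qed

lemma hc_hom_is_hom:
  assumes A: "comm_group A" and y: "y \<in> {1..g} \<rightarrow> carrier A"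
    and yq: "\<And>i. i \<in> {1..g} \<Longrightarrow> y i [^]\<^bsub>A\<^esub> q = \<one>\<^bsub>A\<^esub>" and q: "0 < q"
  shows "hc_hom g A y \<in> hom (homocyclic q g) A"
proof (rule homI)
  interpret A: comm_group A by fact
  have md: "y i [^]\<^bsub>A\<^esub> (n mod q) = y i [^]\<^bsub>A\<^esub> n" if "i \<in> {1..g}" for i and n :: nat
  proof -
    have yi: "y i \<in> carrier A" using y that by auto
    have "y i [^]\<^bsub>A\<^esub> n = y i [^]\<^bsub>A\<^esub> (n mod q + q * (n div q))" by simp
    also have "\<dots> = y i [^]\<^bsub>A\<^esub> (n mod q) \<otimes>\<^bsub>A\<^esub> (y i [^]\<^bsub>A\<^esub> q) [^]\<^bsub>A\<^esub> (n div q)"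
      using yi by (simp only: A.nat_pow_mult A.nat_pow_pow)
    finally show ?thesis using yq[OF that] yi by simp
  qed
  fix a b
  show "hc_hom g A y a \<in> carrier A" unfolding hc_hom_def using y by (intro A.finprod_closed) auto
  have "hc_hom g A y (a \<otimes>\<^bsub>homocyclic q g\<^esub> b) =
      finprod A (\<lambda>i. y i [^]\<^bsub>A\<^esub> a i \<otimes>\<^bsub>A\<^esub> y i [^]\<^bsub>A\<^esub> b i) {1..g}"
    unfolding hc_hom_def
  proof (rule A.finprod_cong')
    show "(\<lambda>i. y i [^]\<^bsub>A\<^esub> a i \<otimes>\<^bsub>A\<^esub> y i [^]\<^bsub>A\<^esub> b i) \<in> {1..g} \<rightarrow> carrier A" using y by auto
    fix i assume i: "i \<in> {1..g}"
    then have "y i [^]\<^bsub>A\<^esub> ((a i + b i) mod q) = y i [^]\<^bsub>A\<^esub> a i \<otimes>\<^bsub>A\<^esub> y i [^]\<^bsub>A\<^esub> b i"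
      using y md[OF i] by (auto simp: A.nat_pow_mult Pi_iff)
    then show "y i [^]\<^bsub>A\<^esub> (a \<otimes>\<^bsub>homocyclic q g\<^esub> b) i = y i [^]\<^bsub>A\<^esub> a i \<otimes>\<^bsub>A\<^esub> y i [^]\<^bsub>A\<^esub> b i"
      using i by (simp add: mult_homocyclic)
  qed simp
  also have "\<dots> = hc_hom g A y a \<otimes>\<^bsub>A\<^esub> hc_hom g A y b"
    unfolding hc_hom_def using y by (intro A.finprod_multf) auto
  finally show "hc_hom g A y (a \<otimes>\<^bsub>homocyclic q g\<^esub> b) = hc_hom g A y a \<otimes>\<^bsub>A\<^esub> hc_hom g A y b" .
qed

lemma hc_hom_unit:
  assumes A: "comm_group A" and y: "y \<in> {1..g} \<rightarrow> carrier A"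
    and yq: "\<And>i. i \<in> {1..g} \<Longrightarrow> y i [^]\<^bsub>A\<^esub> q = \<one>\<^bsub>A\<^esub>" and i: "i \<in> {1..g}"
  shows "hc_hom g A y (hc_unit q g i) = y i"
proof -
  interpret A: comm_group A by fact
  have yi: "y i \<in> carrier A" using y i by auto
  have y1: "y i [^]\<^bsub>A\<^esub> (1 mod q) = y i"
  proof (cases "q = 1")
    case True then show ?thesis using yq[OF i] yi by simp
  next
    case False then show ?thesis using yi by (cases "q = 0") auto
  qed
  have "hc_hom g A y (hc_unit q g i) = finprod A (\<lambda>j. if i = j then y j else \<one>\<^bsub>A\<^esub>) {1..g}"
    unfolding hc_hom_def by (rule A.finprod_cong') (use y y1 in \<open>auto simp: hc_unit_def\<close>)
  also have "\<dots> = y i" using i y by (intro A.finprod_singleton) auto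
  finally show ?thesis .
qed

lemma group_hom_homocyclic_eqI:
  assumes "0 < q" and "group_hom (homocyclic q g) A h" "group_hom (homocyclic q g) A k"
    and "\<And>i. i \<in> {1..g} \<Longrightarrow> h (hc_unit q g i) = k (hc_unit q g i)"
    and "a \<in> carrier (homocyclic q g)"
  shows "h a = k a"
  by (rule group_hom_eq_on_generate[OF assms(2,3), of "hc_unit q g ` {1..g}"])
     (use assms generate_hc_unit[of q g] hc_unit_closed[of q g] in auto)

lemma torsion_homocyclic:
  assumes p: "0 < p" and q: "q = p ^ Suc m" and h: "h \<in> carrier (homocyclic q g)"
  shows "h [^]\<^bsub>homocyclic q g\<^esub> p = \<one>\<^bsub>homocyclic q g\<^esub> \<longleftrightarrow>
      (\<forall>i\<in>{1..g}. p ^ m dvd h i)"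
proof -
  have "p * h i mod q = 0 \<longleftrightarrow> p ^ m dvd h i" for i using p q by (auto simp: mod_eq_0_iff_dvd)
  then show ?thesis unfolding pow_homocyclic[OF h] one_homocyclic
    by (auto simp: fun_eq_iff restrict_def split: if_splits)
qed

text \<open>The use of q = p^(m+1): a homomorphism into a group of exponent dividing p^m kills all
  p-torsion of H. The root is obtained by dividing each coordinate by p^m.\<close>

lemma torsion_homocyclic_is_power:
  assumes p: "0 < p" and q: "q = p ^ Suc m" and h: "h \<in> carrier (homocyclic q g)"
    and hp: "h [^]\<^bsub>homocyclic q g\<^esub> p = \<one>\<^bsub>homocyclic q g\<^esub>"
  obtains k where "k \<in> carrier (homocyclic q g)"
    "h = k [^]\<^bsub>homocyclic q g\<^esub> (p ^ m)"
proof -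
  let ?k = "\<lambda>i\<in>{1..g}. h i div p ^ m"
  have d: "\<forall>i\<in>{1..g}. p ^ m dvd h i" using torsion_homocyclic[OF p q h] hp by simp
  have hl: "h i < q" if "i \<in> {1..g}" for i using h that by (auto simp: carrier_homocyclic)
  have k: "?k \<in> carrier (homocyclic q g)"
  proof -
    have "h i div p ^ m < q" if "i \<in> {1..g}" for i
      using hl[OF that] div_le_dividend le_less_trans by blast
    then show ?thesis by (auto simp: carrier_homocyclic)
  qed
  have "h = ?k [^]\<^bsub>homocyclic q g\<^esub> (p ^ m)"
  proof
    fix i
    show "h i = (?k [^]\<^bsub>homocyclic q g\<^esub> (p ^ m)) i"
    proof (cases "i \<in> {1..g}")
      case True
      then have "p ^ m * (h i div p ^ m) = h i" using d by auto
      then show ?thesis unfolding pow_homocyclic[OF k] using True hl[OF True] by simp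
    next
      case False
      then show ?thesis unfolding pow_homocyclic[OF k] using h
        by (auto simp: carrier_homocyclic PiE_def extensional_def)
    qed
  qed
  with k that show ?thesis by blast
qed

lemma card_torsion_homocyclic:
  assumes p: "0 < p" and q: "q = p ^ Suc m"
  shows "card {h \<in> carrier (homocyclic q g).
      h [^]\<^bsub>homocyclic q g\<^esub> p = \<one>\<^bsub>homocyclic q g\<^esub>} = p ^ g" (is "card ?T = _")
proof -
  have "?T = {1..g} \<rightarrow>\<^sub>E {x. x < q \<and> p ^ m dvd x}"
    using torsion_homocyclic[OF p q, of _ g] by (auto simp: carrier_homocyclic PiE_def Pi_iff)
  moreover have "{x. x < q \<and> p ^ m dvd x} = (\<lambda>k. p ^ m * k) ` {..<p}"
    using p q by (auto elim!: dvdE)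
  moreover have "card ((\<lambda>k. p ^ m * k) ` {..<p}) = p"
    using p by (subst card_image) (auto simp: inj_on_def)
  ultimately show ?thesis by (simp add: card_PiE)
qed

subsection \<open>Counting presentations of a finite abelian p-group\<close>

locale finite_abelian_p_group =
  fixes C :: "'c monoid" and p m g q :: nat
  assumes comm_group_C: "comm_group C" and finite_C: "finite (carrier C)"
    and prime_p: "prime p" and order_C: "order C = p ^ m" and rank_C: "min_num_generators C = g"
    and q_eq: "q = p ^ Suc m"
begin

sublocale C: comm_group C by (rule comm_group_C)

abbreviation H :: "(nat \<Rightarrow> nat) monoid" where "H \<equiv> homocyclic q g"

lemma p_pos: "0 < p" and q_pos: "0 < q"
  using prime_p prime_gt_0_nat q_eq by auto

sublocale H: comm_group H by (rule comm_group_homocyclic[OF q_pos])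

lemma finite_H: "finite (carrier H)" by (rule finite_homocyclic)

definition generating_tuples :: "(nat \<Rightarrow> 'c) set" where
  "generating_tuples = {c \<in> {1..g} \<rightarrow>\<^sub>E carrier C. generate C (c ` {1..g}) = carrier C}"

definition presenting_tuples :: "(nat \<Rightarrow> nat \<Rightarrow> nat) set" where
  "presenting_tuples = {v \<in> {1..g} \<rightarrow>\<^sub>E carrier H. H Mod generate H (v ` {1..g}) \<cong> C}"

lemma exponent_C: "a \<in> carrier C \<Longrightarrow> a [^]\<^bsub>C\<^esub> (p ^ m) = \<one>\<^bsub>C\<^esub>"
  using C.power_order_eq_one[OF finite_C, of a] order_C by (simp add: order_def)

lemma exponent_C': "a \<in> carrier C \<Longrightarrow> a [^]\<^bsub>C\<^esub> q = \<one>\<^bsub>C\<^esub>"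
  using exponent_C[of a] C.nat_pow_pow[of a "p ^ m" p] by (simp add: q_eq mult.commute)

lemma card_C: "card (carrier C) = p ^ g * card ((\<lambda>y. y [^]\<^bsub>C\<^esub> p) ` carrier C)"
  by (rule C.card_eq_rank_powers[OF finite_C prime_p order_C rank_C])

lemma card_generating_tuples_C:
  "card generating_tuples = card ((\<lambda>y. y [^]\<^bsub>C\<^esub> p) ` carrier C) ^ g * (\<Prod>j<g. p ^ g - p ^ j)"
  unfolding generating_tuples_def
  by (rule C.card_generating_tuples[OF finite_C prime_p exponent_C card_C])

lemma group_hom_hc_hom: "c \<in> {1..g} \<rightarrow> carrier C \<Longrightarrow> group_hom H C (hc_hom g C c)"
  using hc_hom_is_hom[OF comm_group_C _ exponent_C' q_pos]
  by (simp add: group_hom_def group_hom_axioms_def Pi_iff H.is_group C.is_group)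

lemma hc_hom_unit_C: "c \<in> {1..g} \<rightarrow> carrier C \<Longrightarrow> i \<in> {1..g} \<Longrightarrow>
    hc_hom g C c (hc_unit q g i) = c i"
  using hc_hom_unit[OF comm_group_C _ exponent_C'] by (auto simp: Pi_iff)

lemma group_hom_image_H:
  assumes "group_hom H C s"
  shows "s ` carrier H = generate C ((\<lambda>i. s (hc_unit q g i)) ` {1..g})"
proof -
  interpret s: group_hom H C s by fact
  have "hc_unit q g ` {1..g} \<subseteq> carrier H" using hc_unit_closed[OF q_pos] by auto
  from s.generate_img[OF this] show ?thesis
    by (simp only: generate_hc_unit[OF q_pos] image_image)
qed

lemma hc_hom_surj:
  assumes "c \<in> generating_tuples"
  shows "hc_hom g C c ` carrier H = carrier C"
proof -
  have c: "c \<in> {1..g} \<rightarrow> carrier C" "generate C (c ` {1..g}) = carrier C"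
    using assms by (auto simp: generating_tuples_def PiE_def)
  have "(\<lambda>i. hc_hom g C c (hc_unit q g i)) ` {1..g} = c ` {1..g}"
    using hc_hom_unit_C[OF c(1)] by (intro image_cong) auto
  then show ?thesis using group_hom_image_H[OF group_hom_hc_hom[OF c(1)]] c(2) by simp
qed

text \<open>The p-th power map on H has the p-torsion as its kernel, which has order p^g.\<close>

lemma card_H: "card (carrier H) = p ^ g * card ((\<lambda>y. y [^]\<^bsub>H\<^esub> p) ` carrier H)"
proof -
  interpret P: group_hom H H "\<lambda>y. y [^]\<^bsub>H\<^esub> p"
    by unfold_locales (auto simp: hom_def H.nat_pow_distrib)
  show ?thesis using P.card_kernel_image[OF finite_H] card_torsion_homocyclic[OF p_pos q_eq, of g]
    by (simp add: kernel_def)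
qed

section \<open>Kernels of epimorphisms from H onto C\<close>

context
  fixes s :: "(nat \<Rightarrow> nat) \<Rightarrow> 'c"
  assumes s_hom: "group_hom H C s" and s_surj: "s ` carrier H = carrier C"
begin

interpretation s: group_hom H C s by (rule s_hom)

lemma card_surj_kernel: "card (carrier C) * card (kernel H C s) = card (carrier H)"
  using s.card_kernel_image[OF finite_H] s_surj by simp

text \<open>The \<open>p\<close>-torsion of the kernel \<open>L\<close> is that of \<open>H\<close>, so \<open>L/pL\<close> has order \<open>p ^ g\<close>.\<close>

lemma card_kernel_rank:
  "card (kernel H C s) = p ^ g * card ((\<lambda>y. y [^]\<^bsub>H\<^esub> p) ` kernel H C s)"
proof -
  let ?L = "kernel H C s" and ?HL = "H\<lparr>carrier := kernel H C s\<rparr>"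
  interpret L: group ?HL by (rule H.subgroup_imp_group[OF s.subgroup_kernel])
  interpret P: group_hom ?HL H "\<lambda>y. y [^]\<^bsub>H\<^esub> p"
    by unfold_locales (auto simp: hom_def H.nat_pow_distrib kernel_def)
  have "kernel ?HL H (\<lambda>y. y [^]\<^bsub>H\<^esub> p) = {h \<in> carrier H. h [^]\<^bsub>H\<^esub> p = \<one>\<^bsub>H\<^esub>}" (is "?A = ?B")
  proof
    show "?A \<subseteq> ?B" by (auto simp: kernel_def)
    show "?B \<subseteq> ?A"
    proof
      fix h assume h: "h \<in> ?B"
      then obtain k where k: "k \<in> carrier H" "h = k [^]\<^bsub>H\<^esub> (p ^ m)"
        using torsion_homocyclic_is_power[OF p_pos q_eq] by blast
      then have "s h = \<one>\<^bsub>C\<^esub>" using exponent_C[of "s k"] by (simp add: s.hom_nat_pow)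
      with h show "h \<in> ?A" by (auto simp: kernel_def)
    qed
  qed
  then show ?thesis using P.card_kernel_image card_torsion_homocyclic[OF p_pos q_eq, of g]
      finite_H by (simp add: kernel_def)
qed

text \<open>Since H and C have the same index p^g over their p-th powers, s induces an isomorphism
  H/pH -> C/pC, so its kernel lies in pH. In the proof, the preimage E of pC contains pH and the
  kernel L, and p^g |E| = p^g |pC| |L| = |C| |L| = |H| = p^g |pH| forces E = pH.\<close>

lemma kernel_subset_powers: "kernel H C s \<subseteq> (\<lambda>y. y [^]\<^bsub>H\<^esub> p) ` carrier H"
proof -
  let ?pC = "(\<lambda>y. y [^]\<^bsub>C\<^esub> p) ` carrier C" and ?pH = "(\<lambda>y. y [^]\<^bsub>H\<^esub> p) ` carrier H"
  let ?E = "{h \<in> carrier H. s h \<in> ?pC}" and ?L = "kernel H C s"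
  have spC: "subgroup ?pC C" by (rule C.subgroup_nat_pow_image[OF C.subgroup_self])
  have sE: "subgroup ?E H"
    by (rule H.subgroupI)
      (use subgroup.one_closed[OF spC] subgroup.m_closed[OF spC] subgroup.m_inv_closed[OF spC]
        H.one_closed s.hom_one in \<open>auto simp del: s.hom_one\<close>)
  have sub: "?pH \<subseteq> ?E" by (auto simp: s.hom_nat_pow)
  interpret E: group "H\<lparr>carrier := ?E\<rparr>" by (rule H.subgroup_imp_group[OF sE])
  interpret sE: group_hom "H\<lparr>carrier := ?E\<rparr>" C s
    by unfold_locales (auto simp: hom_def)
  have "s ` ?E = ?pC" using s_surj C.nat_pow_closed by (auto simp: image_iff) (metis imageE C.nat_pow_closed)
  moreover have "kernel (H\<lparr>carrier := ?E\<rparr>) C s = ?L"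
    using subgroup.one_closed[OF spC] by (auto simp: kernel_def)
  ultimately have "card ?E = card ?pC * card ?L"
    using sE.card_kernel_image finite_H by simp
  then have "p ^ g * card ?E = p ^ g * card ?pH"
    using card_C card_H card_surj_kernel by (metis mult.assoc)
  then have "?E = ?pH" using sub finite_H p_pos by (simp add: card_subset_eq[symmetric])
  then show ?thesis using subgroup.one_closed[OF spC] by (auto simp: kernel_def)
qed

text \<open>The general count applied to the kernel as a group of its own;
  \<open>card_kernel_rank\<close> supplies the index p^g. What remains is to translate powers and
  generated subgroups between H and the subgroup.\<close>

lemma card_generating_tuples_kernel:
  "card {v \<in> {1..g} \<rightarrow>\<^sub>E carrier H. generate H (v ` {1..g}) = kernel H C s}
    = card ((\<lambda>y. y [^]\<^bsub>H\<^esub> p) ` kernel H C s) ^ g * (\<Prod>j<g. p ^ g - p ^ j)"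
proof -
  let ?L = "kernel H C s" and ?HL = "H\<lparr>carrier := kernel H C s\<rparr>"
  have sL: "subgroup ?L H" by (rule s.subgroup_kernel)
  interpret L: comm_group ?HL
    by (rule group.group_comm_groupI[OF H.subgroup_imp_group[OF sL]]) (auto simp: kernel_def H.m_comm)
  have pow: "a [^]\<^bsub>?HL\<^esub> n = a [^]\<^bsub>H\<^esub> n" for a and n :: nat
    using H.nat_pow_consistent[of a n ?L] by simp
  have "{v \<in> {1..g} \<rightarrow>\<^sub>E carrier H. generate H (v ` {1..g}) = ?L} =
      {v \<in> {1..g} \<rightarrow>\<^sub>E carrier ?HL. generate ?HL (v ` {1..g}) = carrier ?HL}"
  proof (intro Collect_cong iffI conjI; elim conjE)
    fix v assume v: "v \<in> {1..g} \<rightarrow>\<^sub>E carrier H" and gen: "generate H (v ` {1..g}) = ?L"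
    have sub: "v ` {1..g} \<subseteq> ?L" using gen generate.incl[of _ "v ` {1..g}" H] by blast
    then show "v \<in> {1..g} \<rightarrow>\<^sub>E carrier ?HL" using v by (auto simp: PiE_def Pi_iff)
    show "generate ?HL (v ` {1..g}) = carrier ?HL" using H.generate_consistent[OF sub sL] gen by simp
  next
    fix v assume v: "v \<in> {1..g} \<rightarrow>\<^sub>E carrier ?HL" and gen: "generate ?HL (v ` {1..g}) = carrier ?HL"
    have sub: "v ` {1..g} \<subseteq> ?L" using v by auto
    then show "v \<in> {1..g} \<rightarrow>\<^sub>E carrier H" using v by (auto simp: PiE_def Pi_iff kernel_def)
    show "generate H (v ` {1..g}) = ?L" using H.generate_consistent[OF sub sL] gen by simp
  qed
  moreover have "card {v \<in> {1..g} \<rightarrow>\<^sub>E carrier ?HL. generate ?HL (v ` {1..g}) = carrier ?HL} =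
      card ((\<lambda>y. y [^]\<^bsub>?HL\<^esub> p) ` carrier ?HL) ^ g * (\<Prod>j<g. p ^ g - p ^ j)"
  proof (rule L.card_generating_tuples[OF _ prime_p])
    show "finite (carrier ?HL)" using finite_H by (simp add: kernel_def)
    show "a [^]\<^bsub>?HL\<^esub> (p ^ Suc m) = \<one>\<^bsub>?HL\<^esub>" if "a \<in> carrier ?HL" for a
    proof -
      have "a \<in> carrier H" using that by (simp add: kernel_def)
      then show ?thesis unfolding pow q_eq[symmetric] using pow_exponent_homocyclic[of a q g] by simp
    qed
    show "card (carrier ?HL) = p ^ g * card ((\<lambda>y. y [^]\<^bsub>?HL\<^esub> p) ` carrier ?HL)"
      using card_kernel_rank by (simp add: pow)
  qed
  ultimately show ?thesis by (simp add: pow)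
qed

end

section \<open>Double counting of epimorphisms and generating tuples\<close>

text \<open>The automorphisms of C act simply transitively on the epimorphisms H -> C with kernel L.
  The isomorphism \<open>iso\<close> yields a base point s, and an automorphism \<alpha> corresponds
  to the values of \<alpha> after s on the standard basis.\<close>

lemma card_same_kernel:
  assumes L: "subgroup L H" and iso: "H Mod L \<cong> C"
  shows "card {c \<in> generating_tuples. kernel H C (hc_hom g C c) = L} = card (auto C)"
proof -
  let ?e = "hc_unit q g"
  have e: "?e i \<in> carrier H" for i by (rule hc_unit_closed[OF q_pos])
  interpret L: normal L H by (rule H.subgroup_imp_normal[OF L])
  obtain b where b: "b \<in> iso (H Mod L) C" using iso by (auto simp: is_iso_def)
  interpret Q: group "H Mod L" by (rule L.factorgroup_is_group)
  define s where "s = (\<lambda>h. b (L #>\<^bsub>H\<^esub> h))"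
  have "s \<in> hom H C"
    using L.r_coset_hom_Mod b unfolding s_def iso_def hom_def by (auto simp: Pi_iff)
  then have s_hom: "group_hom H C s" by unfold_locales
  interpret s: group_hom H C s by (rule s_hom)
  have s_surj: "s ` carrier H = carrier C"
  proof -
    have "s ` carrier H = b ` carrier (H Mod L)" by (simp add: s_def carrier_FactGroup image_image)
    then show ?thesis using b by (simp add: iso_def bij_betw_def)
  qed
  interpret b: group_hom "H Mod L" C b using b by unfold_locales (auto simp: iso_def)
  have s_ker: "kernel H C s = L"
  proof -
    have "s h = \<one>\<^bsub>C\<^esub> \<longleftrightarrow> h \<in> L" if h: "h \<in> carrier H" for h
    proof -
      have "s h = \<one>\<^bsub>C\<^esub> \<longleftrightarrow> b (L #>\<^bsub>H\<^esub> h) = b (\<one>\<^bsub>H Mod L\<^esub>)"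
        using b.hom_one by (simp add: s_def)
      also have "\<dots> \<longleftrightarrow> L #>\<^bsub>H\<^esub> h = L"
        using b h Q.one_closed by (subst inj_on_eq_iff[of b "carrier (H Mod L)"])
          (auto simp: iso_def bij_betw_def carrier_FactGroup)
      also have "\<dots> \<longleftrightarrow> h \<in> L" using h L H.coset_join1 H.coset_join2 by (metis subgroup.subset)
      finally show ?thesis .
    qed
    then show ?thesis using subgroup.subset[OF L] by (auto simp: kernel_def)
  qed
  define c0 where "c0 = (\<lambda>i. s (?e i))"
  have c0: "c0 i \<in> carrier C" for i using e by (simp add: c0_def)
  have c0_gen: "generate C (c0 ` {1..g}) = carrier C"
    using group_hom_image_H[OF s_hom] s_surj by (simp add: c0_def)
  let ?\<Psi> = "\<lambda>\<alpha>. \<lambda>i\<in>{1..g}. \<alpha> (c0 i)"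
  let ?X = "{c \<in> generating_tuples. kernel H C (hc_hom g C c) = L}"
  have "bij_betw ?\<Psi> (auto C) ?X"
    unfolding bij_betw_def
  proof (intro conjI equalityI subsetI)
    have hom_auto: "group_hom C C \<alpha>" if "\<alpha> \<in> auto C" for \<alpha>
      using that by unfold_locales (auto simp: auto_def)
    show "inj_on ?\<Psi> (auto C)"
    proof (rule inj_onI)
      fix \<alpha> \<beta> assume a: "\<alpha> \<in> auto C" and b: "\<beta> \<in> auto C" and eq: "?\<Psi> \<alpha> = ?\<Psi> \<beta>"
      have "\<alpha> y = \<beta> y" if "y \<in> carrier C" for y
      proof (rule group_hom_eq_on_generate[OF hom_auto[OF a] hom_auto[OF b], of "c0 ` {1..g}"])
        show "\<alpha> z = \<beta> z" if "z \<in> c0 ` {1..g}" for z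
          using that eq by (auto simp: fun_eq_iff restrict_def) metis
      qed (use c0 c0_gen that in auto)
      moreover have "\<alpha> \<in> extensional (carrier C)" "\<beta> \<in> extensional (carrier C)"
        using a b by (auto simp: auto_def Bij_def)
      ultimately show "\<alpha> = \<beta>" by (metis extensionalityI)
    qed
    fix c
    assume "c \<in> ?\<Psi> ` auto C"
    then obtain \<alpha> where \<alpha>: "\<alpha> \<in> auto C" and c: "c = ?\<Psi> \<alpha>" by blast
    interpret \<alpha>: group_hom C C \<alpha> by (rule hom_auto[OF \<alpha>])
    have bij: "bij_betw \<alpha> (carrier C) (carrier C)" using \<alpha> by (auto simp: auto_def Bij_def)
    have cE: "c \<in> {1..g} \<rightarrow>\<^sub>E carrier C" using c c0 by auto
    have "c ` {1..g} = \<alpha> ` c0 ` {1..g}" using c by auto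
    then have "generate C (c ` {1..g}) = carrier C"
      using \<alpha>.generate_img[of "c0 ` {1..g}"] c0 c0_gen bij by (auto simp: bij_betw_def)
    then have gt: "c \<in> generating_tuples" using cE by (simp add: generating_tuples_def)
    have "hc_hom g C c h = \<alpha> (s h)" if "h \<in> carrier H" for h
    proof (rule group_hom_homocyclic_eqI[OF q_pos _ _ _ that])
      show "group_hom H C (hc_hom g C c)" using cE by (intro group_hom_hc_hom) auto
      show "group_hom H C (\<lambda>h. \<alpha> (s h))" by unfold_locales (auto simp: hom_def)
      show "hc_hom g C c (?e i) = \<alpha> (s (?e i))" if "i \<in> {1..g}" for i
        using hc_hom_unit_C[of c i] cE that c by (auto simp: c0_def)
    qed
    moreover have "\<alpha> y = \<one>\<^bsub>C\<^esub> \<longleftrightarrow> y = \<one>\<^bsub>C\<^esub>" if "y \<in> carrier C" for y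
      using bij that \<alpha>.hom_one inj_on_eq_iff[of \<alpha> "carrier C" y "\<one>\<^bsub>C\<^esub>"]
      by (simp add: bij_betw_def)
    ultimately have "kernel H C (hc_hom g C c) = kernel H C s"
      unfolding kernel_def by auto
    with gt show "c \<in> ?X" using s_ker by simp
  next
    fix c assume c: "c \<in> ?X"
    let ?t = "hc_hom g C c"
    have cE: "c \<in> {1..g} \<rightarrow>\<^sub>E carrier C" using c by (auto simp: generating_tuples_def)
    have t_hom: "group_hom H C ?t" using cE by (intro group_hom_hc_hom) auto
    interpret t: group_hom H C ?t by (rule t_hom)
    have t_surj: "?t ` carrier H = carrier C" using hc_hom_surj c by auto
    have t_ker: "kernel H C ?t = L" using c by auto
    have t_eq: "?t a = ?t b \<longleftrightarrow> s a = s b" if "a \<in> carrier H" "b \<in> carrier H" for a b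
      using s.hom_eq_iff_kernel[OF that] t.hom_eq_iff_kernel[OF that] s_ker t_ker by simp
    \<comment> \<open>A set-theoretic section of s. As s and \<open>?t\<close> have the same kernel,
      they have the same fibres, so \<open>?t (r y)\<close> is independent of the choice and gives
      the automorphism with \<alpha> after s equal to \<open>?t\<close>. It is restricted because
      \<open>auto C\<close> contains only extensional maps.\<close>
    define r where "r = inv_into (carrier H) s"
    have r: "r y \<in> carrier H" "s (r y) = y" if "y \<in> carrier C" for y
      using that s_surj by (auto simp: r_def inv_into_into f_inv_into_f)
    define \<alpha> where "\<alpha> = (\<lambda>y\<in>carrier C. ?t (r y))"
    have \<alpha>s: "\<alpha> (s h) = ?t h" if "h \<in> carrier H" for h
      using that r[of "s h"] t_eq[of "r (s h)" h] by (simp add: \<alpha>_def)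
    have "\<alpha> \<in> hom C C"
    proof (rule homI)
      fix x y assume xy: "x \<in> carrier C" "y \<in> carrier C"
      show "\<alpha> x \<in> carrier C" using xy r by (simp add: \<alpha>_def)
      have "\<alpha> (x \<otimes>\<^bsub>C\<^esub> y) = \<alpha> (s (r x \<otimes>\<^bsub>H\<^esub> r y))" using xy r by simp
      also have "\<dots> = ?t (r x) \<otimes>\<^bsub>C\<^esub> ?t (r y)" using xy r by (simp only: \<alpha>s H.m_closed t.hom_mult)
      finally show "\<alpha> (x \<otimes>\<^bsub>C\<^esub> y) = \<alpha> x \<otimes>\<^bsub>C\<^esub> \<alpha> y" using xy by (simp add: \<alpha>_def)
    qed
    moreover have "bij_betw \<alpha> (carrier C) (carrier C)"
    proof -
      have "inj_on \<alpha> (carrier C)"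
      proof (rule inj_onI)
        fix x y assume xy: "x \<in> carrier C" "y \<in> carrier C" "\<alpha> x = \<alpha> y"
        then have "s (r x) = s (r y)" using t_eq[of "r x" "r y"] r by (simp add: \<alpha>_def)
        then show "x = y" using r xy by simp
      qed
      moreover have "\<alpha> ` carrier C = ?t ` carrier H"
      proof -
        have "\<alpha> ` carrier C = (\<lambda>h. \<alpha> (s h)) ` carrier H" unfolding s_surj[symmetric] image_image ..
        also have "\<dots> = ?t ` carrier H" using \<alpha>s by (intro image_cong) auto
        finally show ?thesis .
      qed
      ultimately show ?thesis using t_surj by (simp add: bij_betw_def)
    qed
    ultimately have "\<alpha> \<in> auto C" by (auto simp: auto_def Bij_def \<alpha>_def)
    moreover have "c = ?\<Psi> \<alpha>"
    proof
      fix i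
      show "c i = ?\<Psi> \<alpha> i"
      proof (cases "i \<in> {1..g}")
        case True
        then have "\<alpha> (c0 i) = c i" using \<alpha>s[OF e] hc_hom_unit_C[of c i] cE by (auto simp: c0_def PiE_def)
        then show ?thesis using True by simp
      next
        case False then show ?thesis using cE by (auto simp: PiE_def extensional_def)
      qed
    qed
    ultimately show "c \<in> ?\<Psi> ` auto C" by blast
  qed
  then show ?thesis by (rule bij_betw_same_card[symmetric])
qed

lemma card_auto_pos: "0 < card (auto C)"
proof -
  have "auto C \<subseteq> carrier C \<rightarrow>\<^sub>E carrier C" by (auto simp: auto_def Bij_def hom_def PiE_def)
  then have "finite (auto C)" using finite_subset finite_PiE[OF finite_C] finite_C by metis
  then show ?thesis using C.id_in_auto by (auto simp: card_gt_0_iff)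
qed

text \<open>Positivity of |Aut C| turns the count in \<open>card_same_kernel\<close> into existence:
  the span of v is the kernel of an epimorphism, so \<open>kernel_subset_powers\<close> applies.
  Hence no presenting tuple escapes the image of the Frattini subgroup.\<close>

lemma presenting_tuples_powers:
  assumes "v \<in> presenting_tuples"
  shows "v ` {1..g} \<subseteq> (\<lambda>y. y [^]\<^bsub>H\<^esub> p) ` carrier H"
proof -
  let ?L = "generate H (v ` {1..g})"
  have v: "v ` {1..g} \<subseteq> carrier H" and iso: "H Mod ?L \<cong> C" using assms by (auto simp: presenting_tuples_def)
  have sL: "subgroup ?L H" by (rule H.generate_is_subgroup[OF v])
  obtain c where c: "c \<in> generating_tuples" "kernel H C (hc_hom g C c) = ?L"
    using card_same_kernel[OF sL iso] card_auto_pos by (metis (mono_tags, lifting) card.empty empty_Collect_eq less_irrefl)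
  then have "group_hom H C (hc_hom g C c)" by (intro group_hom_hc_hom) (auto simp: generating_tuples_def)
  then show ?thesis using kernel_subset_powers[OF _ hc_hom_surj] c generate.incl[of _ "v ` {1..g}" H] by blast
qed

theorem card_presenting_tuples:
  "card presenting_tuples * card (auto C) * p ^ g\<^sup>2 =
     card ((\<lambda>y. y [^]\<^bsub>H\<^esub> p) ` carrier H) ^ g * (\<Prod>j<g. p ^ g - p ^ j)\<^sup>2"
proof -
  let ?V = "{1..g} \<rightarrow>\<^sub>E carrier H" and ?GL = "\<Prod>j<g. p ^ g - p ^ j"
  let ?K = "\<lambda>c. kernel H C (hc_hom g C c)" and ?gen = "\<lambda>v. generate H (v ` {1..g})"
  let ?pC = "card ((\<lambda>y. y [^]\<^bsub>C\<^esub> p) ` carrier C)" and ?pH = "card ((\<lambda>y. y [^]\<^bsub>H\<^esub> p) ` carrier H)"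
  have finV: "finite ?V" using finite_H by (intro finite_PiE) auto
  have finG: "finite generating_tuples" unfolding generating_tuples_def
    by (rule finite_subset[OF _ finite_PiE[of "{1..g}" "\<lambda>_. carrier C"]]) (use finite_C in auto)
  \<comment> \<open>With c fixed: the number of generating tuples of the kernel depends on the p-th
    powers of that kernel, but after multiplication by \<open>p ^ g\<^sup>2 * ?pC ^ g\<close> the
    dependence on c disappears. The multiplication also keeps the whole count in the natural
    numbers.\<close>
  have row: "p ^ g\<^sup>2 * (?pC ^ g * card {v \<in> ?V. ?K c = ?gen v}) = ?pH ^ g * ?GL"
    if c: "c \<in> generating_tuples" for c
  proof -
    let ?pL = "card ((\<lambda>y. y [^]\<^bsub>H\<^esub> p) ` ?K c)"
    have hom: "group_hom H C (hc_hom g C c)"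
      using c by (intro group_hom_hc_hom) (auto simp: generating_tuples_def)
    note hs = hom hc_hom_surj[OF c]
    have "p ^ g * (?pC * (p ^ g * ?pL)) = p ^ g * ?pH"
      using card_surj_kernel[OF hs] card_kernel_rank[OF hs] card_C card_H by (metis mult.assoc)
    then have "?pC * (p ^ g * ?pL) = ?pH" using p_pos by simp
    then have "?pH ^ g = ?pC ^ g * ((p ^ g) ^ g * ?pL ^ g)" by (metis power_mult_distrib)
    moreover have "card {v \<in> ?V. ?K c = ?gen v} = ?pL ^ g * ?GL"
      unfolding card_generating_tuples_kernel[OF hs, symmetric] by (rule arg_cong[of _ _ card]) auto
    ultimately show ?thesis
      by (simp add: power_mult[symmetric] power2_eq_square ac_simps)
  qed
  \<comment> \<open>With v fixed: if some kernel equals the span of v, the first isomorphism theorem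
    makes v presenting; otherwise the column is empty.\<close>
  have col: "card {c \<in> generating_tuples. ?K c = ?gen v} = (if v \<in> presenting_tuples then card (auto C) else 0)"
    if v: "v \<in> ?V" for v
  proof (cases "v \<in> presenting_tuples")
    case True
    have "subgroup (?gen v) H" using v by (intro H.generate_is_subgroup) auto
    then show ?thesis using card_same_kernel True by (simp add: presenting_tuples_def)
  next
    case False
    have "{c \<in> generating_tuples. ?K c = ?gen v} = {}"
    proof (rule ccontr)
      assume "{c \<in> generating_tuples. ?K c = ?gen v} \<noteq> {}"
      then obtain c where c: "c \<in> generating_tuples" "?K c = ?gen v" by blast
      interpret s: group_hom H C "hc_hom g C c"
        using c by (intro group_hom_hc_hom) (auto simp: generating_tuples_def)
      have "H Mod ?gen v \<cong> C" using s.FactGroup_iso[OF hc_hom_surj[OF c(1)]] c(2) by simp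
      then show False using False v by (simp add: presenting_tuples_def)
    qed
    then show ?thesis using False by (metis card.empty)
  qed
  have "card presenting_tuples * card (auto C) = (\<Sum>v\<in>?V. card {c \<in> generating_tuples. ?K c = ?gen v})"
  proof -
    have "presenting_tuples \<subseteq> ?V" by (auto simp: presenting_tuples_def)
    then have "?V \<inter> presenting_tuples = presenting_tuples" by blast
    then show ?thesis using finV col by (simp add: sum.If_cases)
  qed
  also have "\<dots> = (\<Sum>v\<in>?V. \<Sum>c\<in>generating_tuples. if ?K c = ?gen v then 1 else 0)"
    using finG by (simp add: sum.If_cases Int_def)
  also have "\<dots> = (\<Sum>c\<in>generating_tuples. \<Sum>v\<in>?V. if ?K c = ?gen v then 1 else 0)" by (rule sum.swap)
  also have "\<dots> = (\<Sum>c\<in>generating_tuples. card {v \<in> ?V. ?K c = ?gen v})"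
    using finV by (simp add: sum.If_cases Int_def)
  finally have "card presenting_tuples * card (auto C) * (p ^ g\<^sup>2 * ?pC ^ g) =
      (\<Sum>c\<in>generating_tuples. p ^ g\<^sup>2 * (?pC ^ g * card {v \<in> ?V. ?K c = ?gen v}))"
    by (simp add: sum_distrib_left mult.assoc mult.commute)
  also have "\<dots> = card generating_tuples * (?pH ^ g * ?GL)" using row by simp
  also have "\<dots> = ?pC ^ g * (?pH ^ g * ?GL\<^sup>2)"
    using card_generating_tuples_C by (simp add: power2_eq_square ac_simps)
  finally have "?pC ^ g * (card presenting_tuples * card (auto C) * p ^ g\<^sup>2) = ?pC ^ g * (?pH ^ g * ?GL\<^sup>2)"
    by (simp add: ac_simps)
  moreover have "?pC \<noteq> 0" using finite_C C.one_closed by auto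
  ultimately show ?thesis by simp
qed

end

subsection \<open>Quotients of groups\<close>

lemma (in group) normal_of_derived_subset:
  assumes P: "subgroup P G" and "derived G (carrier G) \<subseteq> P"
  shows "P \<lhd> G"
  unfolding normal_inv_iff
proof (intro conjI ballI)
  fix a h assume a: "a \<in> carrier G" and h: "h \<in> P"
  have hc: "h \<in> carrier G" using subgroup.subset[OF P] h by auto
  have "a \<otimes> h \<otimes> inv a \<otimes> inv h \<in> derived G (carrier G)"
    unfolding derived_def using a hc by (intro generate.incl) auto
  then have "(a \<otimes> h \<otimes> inv a \<otimes> inv h) \<otimes> h \<in> P"
    using assms h subgroup.m_closed[OF P] by blast
  then show "a \<otimes> h \<otimes> inv a \<in> P" using a hc by (simp add: m_assoc)
qed (rule P)

lemma (in group) comm_group_Mod_derived_subset: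
  assumes P: "subgroup P G" and "derived G (carrier G) \<subseteq> P"
  shows "comm_group (G Mod P)"
proof -
  interpret P: normal P G by (rule normal_of_derived_subset[OF assms])
  interpret Q: group "G Mod P" by (rule P.factorgroup_is_group)
  show ?thesis
  proof (rule Q.group_comm_groupI)
    fix X Y assume "X \<in> carrier (G Mod P)" "Y \<in> carrier (G Mod P)"
    then obtain a b where ab: "a \<in> carrier G" "b \<in> carrier G" "X = P #> a" "Y = P #> b"
      by (auto simp: carrier_FactGroup)
    have "a \<otimes> b \<otimes> inv a \<otimes> inv b \<in> derived G (carrier G)"
      unfolding derived_def using ab by (intro generate.incl) auto
    then have "(a \<otimes> b \<otimes> inv a \<otimes> inv b) \<otimes> (b \<otimes> a) \<in> P #> (b \<otimes> a)"
      using assms ab by (intro rcosI) (auto dest: subgroup.subset)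
    moreover have "(a \<otimes> b \<otimes> inv a \<otimes> inv b) \<otimes> (b \<otimes> a) = a \<otimes> b"
    proof -
      have "(a \<otimes> b \<otimes> inv a \<otimes> inv b) \<otimes> (b \<otimes> a) = a \<otimes> b \<otimes> (inv a \<otimes> ((inv b \<otimes> b) \<otimes> a))"
        using ab by (simp only: m_assoc m_closed inv_closed)
      then show ?thesis using ab by simp
    qed
    ultimately have "P #> (a \<otimes> b) = P #> (b \<otimes> a)"
      using ab P.subgroup_axioms by (metis repr_independence m_closed)
    then show "X \<otimes>\<^bsub>G Mod P\<^esub> Y = Y \<otimes>\<^bsub>G Mod P\<^esub> X"
      using ab by (simp add: P.rcos_sum)
  qed
qed

lemma (in normal) rcos_eq_iff:
  assumes "a \<in> carrier G" shows "H #> a = H \<longleftrightarrow> a \<in> H"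
  using assms coset_join1[OF _ assms] coset_join2[OF assms] subset subgroup_axioms by blast

lemma (in group_hom) normal_vimage:
  assumes "J \<lhd> H"
  shows "{a \<in> carrier G. h a \<in> J} \<lhd> G"
proof -
  interpret J: normal J H by fact
  show ?thesis
    unfolding G.normal_inv_iff using assms[unfolded H.normal_inv_iff]
    by (auto intro!: G.subgroupI simp: J.m_closed J.m_inv_closed)
qed

lemma (in group_hom) Mod_vimage_iso:
  assumes "h ` carrier G = carrier H" and "J \<lhd> H"
  shows "G Mod {a \<in> carrier G. h a \<in> J} \<cong> H Mod J"
proof -
  interpret J: normal J H by fact
  interpret Q: group "H Mod J" by (rule J.factorgroup_is_group)
  interpret k: group_hom G "H Mod J" "\<lambda>a. J #>\<^bsub>H\<^esub> h a"
    by unfold_locales (auto simp: hom_def carrier_FactGroup J.rcos_sum)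
  have "(\<lambda>a. J #>\<^bsub>H\<^esub> h a) ` carrier G = carrier (H Mod J)"
    unfolding carrier_FactGroup assms(1)[symmetric] image_image ..
  moreover have "kernel G (H Mod J) (\<lambda>a. J #>\<^bsub>H\<^esub> h a) = {a \<in> carrier G. h a \<in> J}"
    using J.rcos_eq_iff by (fastforce simp: kernel_def)
  ultimately show ?thesis using k.FactGroup_iso by simp
qed

lemma (in normal) nat_pow_mem_of_Mod_iso:
  assumes "group C" and "G Mod H \<cong> C" and exp: "\<And>c. c \<in> carrier C \<Longrightarrow> c [^]\<^bsub>C\<^esub> (n::nat) = \<one>\<^bsub>C\<^esub>"
    and a: "a \<in> carrier G"
  shows "a [^] n \<in> H"
proof -
  interpret C: group C by fact
  interpret Q: group "G Mod H" by (rule factorgroup_is_group)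
  obtain b where b: "b \<in> iso (G Mod H) C" using assms(2) by (auto simp: is_iso_def)
  interpret b: group_hom "G Mod H" C b using b by unfold_locales (auto simp: iso_def)
  have aH: "H #> a \<in> carrier (G Mod H)" using a by (auto simp: carrier_FactGroup)
  have "b ((H #> a) [^]\<^bsub>G Mod H\<^esub> n) = b \<one>\<^bsub>G Mod H\<^esub>"
    using exp[of "b (H #> a)"] aH by (simp add: b.hom_nat_pow del: one_FactGroup)
  then have "(H #> a) [^]\<^bsub>G Mod H\<^esub> n = \<one>\<^bsub>G Mod H\<^esub>"
    using b aH Q.nat_pow_closed Q.one_closed by (auto simp: iso_def bij_betw_def dest!: inj_onD)
  then show ?thesis using FactGroup_pow[OF a] a by (simp add: rcos_eq_iff)
qed

subsection \<open>Topological groups\<close>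

locale topgroup = group F for F :: "('a, 'm) monoid_scheme" (structure) + fixes T :: "'a topology"
  assumes topgroup: "topological_group F T"
begin

lemma topspace_eq: "topspace T = carrier F"
  using topgroup by (simp add: topological_group_def)

lemma continuous_map_mult: "continuous_map (prod_topology T T) T (\<lambda>(a, b). a \<otimes> b)"
  and continuous_map_inv: "continuous_map T T (\<lambda>a. inv a)"
  using topgroup by (auto simp: topological_group_def)

lemma continuous_map_mult2:
  assumes "continuous_map X T f" "continuous_map X T k"
  shows "continuous_map X T (\<lambda>a. f a \<otimes> k a)"
proof -
  have "continuous_map X (prod_topology T T) (\<lambda>a. (f a, k a))"
    using assms by (simp add: continuous_map_pairedI)
  from continuous_map_compose[OF this continuous_map_mult] show ?thesis by (simp add: comp_def)
qed

lemma subgroup_closure_of: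
  assumes "subgroup S F"
  shows "subgroup (T closure_of S) F"
proof (rule subgroupI)
  have S: "S \<subseteq> topspace T" using subgroup.subset[OF assms] topspace_eq by simp
  show "T closure_of S \<subseteq> carrier F" using closure_of_subset_topspace[of T S] topspace_eq by simp
  show "T closure_of S \<noteq> {}" using closure_of_subset[OF S] subgroup.one_closed[OF assms] by auto
  show "inv a \<in> T closure_of S" if "a \<in> T closure_of S" for a
  proof -
    have "inv a \<in> T closure_of ((\<lambda>a. inv a) ` S)"
      using continuous_map_image_closure_subset[OF continuous_map_inv] that by blast
    moreover have "(\<lambda>a. inv a) ` S \<subseteq> S" using subgroup.m_inv_closed[OF assms] by auto
    ultimately show ?thesis using closure_of_mono by blast
  qed
  show "a \<otimes> b \<in> T closure_of S" if "a \<in> T closure_of S" "b \<in> T closure_of S" for a b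
  proof -
    have "(a, b) \<in> prod_topology T T closure_of (S \<times> S)" using that by (simp add: closure_of_Times)
    then have "a \<otimes> b \<in> T closure_of ((\<lambda>(a, b). a \<otimes> b) ` (S \<times> S))"
      using continuous_map_image_closure_subset[OF continuous_map_mult] by blast
    moreover have "(\<lambda>(a, b). a \<otimes> b) ` (S \<times> S) \<subseteq> S" using subgroup.m_closed[OF assms] by auto
    ultimately show ?thesis using closure_of_mono by blast
  qed
qed

lemma openin_translate_vimage:
  assumes "openin T U" "a \<in> carrier F"
  shows "openin T {b \<in> carrier F. a \<otimes> b \<in> U}"
proof -
  have "continuous_map T T (\<lambda>b. a \<otimes> b)"
    using assms by (intro continuous_map_mult2) (auto simp: topspace_eq)
  from openin_continuous_map_preimage[OF this assms(1)] show ?thesis by (simp add: topspace_eq)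
qed

lemma openin_subgroup_supset:
  assumes V: "subgroup V F" "openin T V" and U: "subgroup U F" "V \<subseteq> U"
  shows "openin T U"
proof (subst openin_subopen, intro ballI)
  fix a assume a: "a \<in> U"
  then have ac: "a \<in> carrier F" using subgroup.subset[OF U(1)] by auto
  \<comment> \<open>This set is the coset aV, written as the preimage of V under a translation; U is
    a union of such cosets.\<close>
  have "openin T {b \<in> carrier F. inv a \<otimes> b \<in> V}" using ac by (intro openin_translate_vimage V) auto
  moreover have "a \<in> {b \<in> carrier F. inv a \<otimes> b \<in> V}" using ac subgroup.one_closed[OF V(1)] by simp
  moreover have "{b \<in> carrier F. inv a \<otimes> b \<in> V} \<subseteq> U"
  proof
    fix b assume b: "b \<in> {b \<in> carrier F. inv a \<otimes> b \<in> V}"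
    then have "a \<otimes> (inv a \<otimes> b) \<in> U" using a U subgroup.m_closed[OF U(1)] by blast
    then show "b \<in> U" using b ac by (simp add: m_assoc[symmetric])
  qed
  ultimately show "\<exists>W. openin T W \<and> a \<in> W \<and> W \<subseteq> U" by blast
qed

end

lemma finite_discrete_pro_p_group:
  assumes B: "group B" and fin: "finite (carrier B)" and p: "prime p" and ord: "order B = p ^ k"
  shows "pro_p_group p B (discrete_topology (carrier B))"
proof -
  interpret B: group B by fact
  have tg: "topological_group B (discrete_topology (carrier B))"
    unfolding topological_group_def prod_topology_discrete_topology[symmetric]
    by (auto simp: B)
  moreover have "\<exists>H. subgroup H B \<and> openin (discrete_topology (carrier B)) H \<and> H \<subseteq> U"
    if "\<one>\<^bsub>B\<^esub> \<in> U" for U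
    using that by (intro exI[of _ "{\<one>\<^bsub>B\<^esub>}"]) (auto simp: B.triv_subgroup)
  moreover have "\<exists>j. card (rcosets\<^bsub>B\<^esub> N) = p ^ j" if "N \<lhd> B" for N
  proof -
    have "card (rcosets\<^bsub>B\<^esub> N) * card N = p ^ k"
      using B.lagrange[OF normal_imp_subgroup[OF that]] ord by simp
    then show ?thesis using p by (metis divides_primepow_nat dvd_triv_left)
  qed
  ultimately show ?thesis
    using fin unfolding pro_p_group_def profinite_group_def
    by (auto simp: compact_space_discrete_topology)
qed

lemma continuous_map_into_discrete:
  assumes "\<And>a. a \<in> topspace X \<Longrightarrow> f a \<in> S"
    and "\<And>b. b \<in> S \<Longrightarrow> openin X {a \<in> topspace X. f a = b}"
  shows "continuous_map X (discrete_topology S) f"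
  unfolding continuous_map_def
proof (intro conjI allI impI)
  show "f \<in> topspace X \<rightarrow> topspace (discrete_topology S)" using assms(1) by auto
  fix U assume "openin (discrete_topology S) U"
  then have "U \<subseteq> S" by simp
  have "{a \<in> topspace X. f a \<in> U} = (\<Union>b\<in>U. {a \<in> topspace X. f a = b})" by auto
  then show "openin X {a \<in> topspace X. f a \<in> U}" using \<open>U \<subseteq> S\<close> assms(2) by (auto intro!: openin_Union)
qed

subsection \<open>Free pro-p groups\<close>

locale free_pro_p =
  fixes p g :: nat and F :: "'a monoid" and T :: "'a topology" and x :: "nat \<Rightarrow> 'a"
  assumes prime_p: "prime p" and free: "free_pro_p_group p F T {1..g} x"
begin

lemma pro_p: "pro_p_group p F T" using free by (simp add: free_pro_p_group_def)

lemma tg: "topological_group F T" using pro_p by (simp add: pro_p_group_def profinite_group_def)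

sublocale F: topgroup F T
  using tg by (auto simp: topgroup_def topgroup_axioms_def topological_group_def)

lemma x_closed: "i \<in> {1..g} \<Longrightarrow> x i \<in> carrier F" using free by (auto simp: free_pro_p_group_def)

lemma universal:
  fixes B :: "(nat \<Rightarrow> nat) monoid"
  assumes "pro_p_group p B S" "a \<in> {1..g} \<rightarrow> carrier B"
  shows "\<exists>!\<phi>. \<phi> \<in> extensional (carrier F) \<and> \<phi> \<in> hom F B \<and> continuous_map T S \<phi> \<and>
      (\<forall>i\<in>{1..g}. \<phi> (x i) = a i)"
  using assms free unfolding free_pro_p_group_def by blast

lemma hom_unique:
  fixes B :: "(nat \<Rightarrow> nat) monoid"
  assumes B: "pro_p_group p B S" and \<alpha>: "\<alpha> \<in> hom F B" "continuous_map T S \<alpha>"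
    and \<beta>: "\<beta> \<in> hom F B" "continuous_map T S \<beta>"
    and eq: "\<And>i. i \<in> {1..g} \<Longrightarrow> \<alpha> (x i) = \<beta> (x i)" and a: "a \<in> carrier F"
  shows "\<alpha> a = \<beta> a"
proof -
  \<comment> \<open>The universal property speaks of extensional maps only, so both homomorphisms
    are cut down to the carrier before they are compared.\<close>
  let ?r = "\<lambda>f. restrict f (carrier F)"
  have h: "?r f \<in> hom F B" if "f \<in> hom F B" for f
    by (rule F.hom_restrict[OF that]) simp
  have c: "continuous_map T S (?r f)" if "continuous_map T S f" for f
    using that by (rule continuous_map_eq) (auto simp: F.topspace_eq)
  have "\<beta> \<circ> x \<in> {1..g} \<rightarrow> carrier B" using \<beta>(1) x_closed by (auto simp: hom_def)
  note ex1 = universal[OF B this]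
  have "?r \<alpha> \<in> extensional (carrier F) \<and> ?r \<alpha> \<in> hom F B \<and> continuous_map T S (?r \<alpha>) \<and>
      (\<forall>i\<in>{1..g}. ?r \<alpha> (x i) = (\<beta> \<circ> x) i)"
    using h[OF \<alpha>(1)] c[OF \<alpha>(2)] eq x_closed by auto
  moreover have "?r \<beta> \<in> extensional (carrier F) \<and> ?r \<beta> \<in> hom F B \<and> continuous_map T S (?r \<beta>) \<and>
      (\<forall>i\<in>{1..g}. ?r \<beta> (x i) = (\<beta> \<circ> x) i)"
    using h[OF \<beta>(1)] c[OF \<beta>(2)] x_closed by auto
  ultimately have "?r \<alpha> = ?r \<beta>" using ex1 by blast
  then show ?thesis using a by (metis restrict_apply')
qed

text \<open>Quotients F/U have cosets as elements and are not among the test groups of the universal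
  property. A finite group can be copied onto constant functions of type
  \<open>nat \<Rightarrow> nat\<close>, and uniqueness is pulled back along this injection.\<close>

lemma hom_unique_finite:
  fixes B :: "'b set monoid"
  assumes B: "group B" "finite (carrier B)" "order B = p ^ k"
    and \<alpha>: "\<alpha> \<in> hom F B" "continuous_map T (discrete_topology (carrier B)) \<alpha>"
    and \<beta>: "\<beta> \<in> hom F B" "continuous_map T (discrete_topology (carrier B)) \<beta>"
    and eq: "\<And>i. i \<in> {1..g} \<Longrightarrow> \<alpha> (x i) = \<beta> (x i)" and a: "a \<in> carrier F"
  shows "\<alpha> a = \<beta> a"
proof -
  obtain n and f :: "'b set \<Rightarrow> nat" where f: "inj_on f (carrier B)"
    using finite_imp_inj_to_nat_seg[OF B(2)] by blast
  define r :: "'b set \<Rightarrow> nat \<Rightarrow> nat" where "r b = (\<lambda>_. f b)" for b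
  have r: "inj_on r (carrier B)" using f by (auto simp: inj_on_def r_def fun_eq_iff)
  let ?B = "flatten B r"
  have cB: "carrier ?B = r ` carrier B" by (simp add: flatten_def)
  have pp: "pro_p_group p ?B (discrete_topology (carrier ?B))"
  proof (rule finite_discrete_pro_p_group[OF _ _ prime_p])
    show "group ?B" by (rule flatten_set_group[OF B(1) r])
    show "finite (carrier ?B)" using B(2) cB by simp
    show "order ?B = p ^ k" using B(3) cB card_image[OF r] by (simp add: order_def)
  qed
  have rh: "r \<in> hom B ?B" by (rule flatten_set_group_hom[OF B(1) r])
  have r\<gamma>: "r \<circ> \<gamma> \<in> hom F ?B" "continuous_map T (discrete_topology (carrier ?B)) (r \<circ> \<gamma>)"
    if "\<gamma> \<in> hom F B" "continuous_map T (discrete_topology (carrier B)) \<gamma>" for \<gamma>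
    using that rh by (auto simp: hom_def cB intro!: continuous_map_compose[of _ "discrete_topology (carrier B)"])
  have "(r \<circ> \<alpha>) a = (r \<circ> \<beta>) a"
    by (rule hom_unique[OF pp r\<gamma>(1)[OF \<alpha>] r\<gamma>(2)[OF \<alpha>] r\<gamma>(1)[OF \<beta>] r\<gamma>(2)[OF \<beta>] _ a]) (simp add: eq)
  moreover have "\<alpha> a \<in> carrier B" "\<beta> a \<in> carrier B" using \<alpha>(1) \<beta>(1) a by (auto simp: hom_def)
  ultimately show ?thesis using r by (simp add: inj_on_eq_iff)
qed

lemma open_subgroup_subset:
  assumes "openin T W" "\<one>\<^bsub>F\<^esub> \<in> W"
  obtains V where "subgroup V F" "openin T V" "V \<subseteq> W"
proof -
  have "\<forall>U. openin T U \<and> \<one>\<^bsub>F\<^esub> \<in> U \<longrightarrow> (\<exists>H. subgroup H F \<and> openin T H \<and> H \<subseteq> U)"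
    using pro_p by (simp add: pro_p_group_def profinite_group_def)
  with assms that show thesis by metis
qed

text \<open>As P is closed, some open subgroup V has aV disjoint from P. Then U = PV misses a, is
  open because it contains V, and is normal because it contains the derived subgroup.\<close>

lemma separate_by_open_normal:
  assumes P: "subgroup P F" "closedin T P" "derived F (carrier F) \<subseteq> P"
    and a: "a \<in> carrier F" "a \<notin> P"
  obtains U where "U \<lhd> F" "openin T U" "P \<subseteq> U" "a \<notin> U"
proof -
  have "openin T (topspace T - P)" using P(2) by blast
  then have "openin T {b \<in> carrier F. a \<otimes>\<^bsub>F\<^esub> b \<in> topspace T - P}"
    by (rule F.openin_translate_vimage[OF _ a(1)])
  moreover have "\<one>\<^bsub>F\<^esub> \<in> {b \<in> carrier F. a \<otimes>\<^bsub>F\<^esub> b \<in> topspace T - P}"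
    using a by (simp add: F.topspace_eq)
  ultimately obtain V where V: "subgroup V F" "openin T V"
      "V \<subseteq> {b \<in> carrier F. a \<otimes>\<^bsub>F\<^esub> b \<in> topspace T - P}"
    by (rule open_subgroup_subset)
  interpret P: normal P F by (rule F.normal_of_derived_subset[OF P(1,3)])
  interpret V: subgroup V F by (rule V(1))
  let ?U = "P <#>\<^bsub>F\<^esub> V"
  interpret PV: second_isomorphism_grp P F V by unfold_locales
  note PU = PV.H_contained_in_set_mult and VU = PV.S_contained_in_set_mult
    and sU = PV.normal_set_mult_subgroup
  have "a \<notin> ?U"
  proof
    assume "a \<in> ?U"
    then obtain u v where uv: "u \<in> P" "v \<in> V" "a = u \<otimes>\<^bsub>F\<^esub> v" by (auto simp: set_mult_def)
    then have "a \<otimes>\<^bsub>F\<^esub> inv\<^bsub>F\<^esub> v = u" by (simp add: F.m_assoc)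
    moreover have "a \<otimes>\<^bsub>F\<^esub> inv\<^bsub>F\<^esub> v \<notin> P" using V(3) V.m_inv_closed[OF uv(2)] by blast
    ultimately show False using uv(1) by simp
  qed
  moreover have "?U \<lhd> F" using F.normal_of_derived_subset[OF sU] P(3) PU by blast
  moreover have "openin T ?U" by (rule F.openin_subgroup_supset[OF V(1,2) sU VU])
  ultimately show thesis using that PU by blast
qed

lemma quotient_hom_continuous:
  assumes U: "U \<lhd> F" "openin T U"
  shows "continuous_map T (discrete_topology (carrier (F Mod U))) (\<lambda>a. U #>\<^bsub>F\<^esub> a)"
proof (rule continuous_map_into_discrete)
  interpret U: normal U F by (rule U(1))
  show "U #>\<^bsub>F\<^esub> a \<in> carrier (F Mod U)" if "a \<in> topspace T" for a
    using that by (auto simp: carrier_FactGroup F.topspace_eq)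
  fix X assume "X \<in> carrier (F Mod U)"
  then obtain b where b: "b \<in> carrier F" "X = U #>\<^bsub>F\<^esub> b" by (auto simp: carrier_FactGroup)
  have "{a \<in> topspace T. U #>\<^bsub>F\<^esub> a = X} = {a \<in> carrier F. inv\<^bsub>F\<^esub> b \<otimes>\<^bsub>F\<^esub> a \<in> U}"
  proof -
    have "U #>\<^bsub>F\<^esub> a = U #>\<^bsub>F\<^esub> b \<longleftrightarrow> inv\<^bsub>F\<^esub> b \<otimes>\<^bsub>F\<^esub> a \<in> U" if a: "a \<in> carrier F" for a
    proof -
      have "U #>\<^bsub>F\<^esub> a = U #>\<^bsub>F\<^esub> b \<longleftrightarrow> a \<in> U #>\<^bsub>F\<^esub> b"
        using a b U.subgroup_axioms by (metis F.repr_independence F.rcos_self)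
      also have "\<dots> \<longleftrightarrow> a \<in> b <#\<^bsub>F\<^esub> U" using U.coset_eq b by simp
      also have "\<dots> \<longleftrightarrow> inv\<^bsub>F\<^esub> b \<otimes>\<^bsub>F\<^esub> a \<in> U"
      proof
        assume "a \<in> b <#\<^bsub>F\<^esub> U"
        then obtain u where "u \<in> U" "a = b \<otimes>\<^bsub>F\<^esub> u" by (auto simp: l_coset_def)
        then show "inv\<^bsub>F\<^esub> b \<otimes>\<^bsub>F\<^esub> a \<in> U" using b by (simp flip: F.m_assoc)
      next
        assume "inv\<^bsub>F\<^esub> b \<otimes>\<^bsub>F\<^esub> a \<in> U"
        moreover have "a = b \<otimes>\<^bsub>F\<^esub> (inv\<^bsub>F\<^esub> b \<otimes>\<^bsub>F\<^esub> a)" using a b by (simp flip: F.m_assoc)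
        ultimately show "a \<in> b <#\<^bsub>F\<^esub> U" unfolding l_coset_def by blast
      qed
      finally show ?thesis .
    qed
    then show ?thesis using b by (auto simp: F.topspace_eq)
  qed
  then show "openin T {a \<in> topspace T. U #>\<^bsub>F\<^esub> a = X}"
    using F.openin_translate_vimage[OF U(2), of "inv\<^bsub>F\<^esub> b"] b by simp
qed

end

subsection \<open>Reduction of the presented abelianization to a finite quotient\<close>

locale homocyclic_quotient = free_pro_p p g F T x + finite_abelian_p_group C p m g q
  for p g F T x C m q +
  fixes \<phi> :: "'a \<Rightarrow> nat \<Rightarrow> nat"
  assumes \<phi>_hom: "\<phi> \<in> hom F H"
    and \<phi>_continuous: "continuous_map T (discrete_topology (carrier H)) \<phi>"
    and \<phi>_x: "i \<in> {1..g} \<Longrightarrow> \<phi> (x i) = hc_unit q g i"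
begin

sublocale \<phi>: group_hom F H \<phi> by unfold_locales (rule \<phi>_hom)

lemma H_pro_p: "pro_p_group p H (discrete_topology (carrier H))"
  by (rule finite_discrete_pro_p_group[OF H.is_group finite_H prime_p, of "Suc m * g"])
     (simp only: order_def card_homocyclic q_eq power_mult)

lemma \<phi>_surj: "\<phi> ` carrier F = carrier H"
proof
  show "\<phi> ` carrier F \<subseteq> carrier H" by auto
  have "hc_unit q g ` {1..g} \<subseteq> \<phi> ` carrier F"
  proof
    fix h assume "h \<in> hc_unit q g ` {1..g}"
    then obtain i where "i \<in> {1..g}" "h = \<phi> (x i)" using \<phi>_x by force
    then show "h \<in> \<phi> ` carrier F" using x_closed by blast
  qed
  then show "carrier H \<subseteq> \<phi> ` carrier F"
    using H.generate_subgroup_incl[OF _ \<phi>.img_is_subgroup] generate_hc_unit[OF q_pos, of g] by blast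
qed

lemma openin_\<phi>_vimage: "openin T {a \<in> carrier F. \<phi> a \<in> J}"
proof -
  have "openin T {a \<in> topspace T. \<phi> a \<in> J \<inter> carrier H}"
    by (rule openin_continuous_map_preimage[OF \<phi>_continuous]) simp
  moreover have "{a \<in> topspace T. \<phi> a \<in> J \<inter> carrier H} = {a \<in> carrier F. \<phi> a \<in> J}"
    by (auto simp: F.topspace_eq)
  ultimately show ?thesis by simp
qed

lemma closedin_\<phi>_vimage: "closedin T {a \<in> carrier F. \<phi> a \<in> J}"
proof -
  have "topspace T - {a \<in> carrier F. \<phi> a \<in> J} = {a \<in> carrier F. \<phi> a \<in> - J}"
    by (auto simp: F.topspace_eq)
  then show ?thesis using openin_\<phi>_vimage[of "- J"] by (auto simp: closedin_def F.topspace_eq)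
qed

text \<open>
  An abelian quotient \<open>F/U\<close> of exponent dividing \<open>q\<close> receives a homomorphism from \<open>H\<close>, and by
  uniqueness in the universal property \<open>F \<rightarrow> F/U\<close> factors through it.
\<close>

lemma kernel_\<phi>_subset:
  assumes U: "U \<lhd> F" "openin T U" "derived F (carrier F) \<subseteq> U"
    and pow: "\<And>a. a \<in> carrier F \<Longrightarrow> a [^]\<^bsub>F\<^esub> q \<in> U"
  shows "kernel F H \<phi> \<subseteq> U"
proof
  interpret U: normal U F by (rule U(1))
  let ?B = "F Mod U"
  have cB: "comm_group ?B" by (rule F.comm_group_Mod_derived_subset[OF U.subgroup_axioms U(3)])
  interpret B: comm_group ?B by (rule cB)
  obtain k where k: "card (rcosets\<^bsub>F\<^esub> U) = p ^ k"
    using pro_p U(1,2) unfolding pro_p_group_def by blast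
  have ord: "order ?B = p ^ k" using k by (simp add: order_def FactGroup_def)
  have fin: "finite (carrier ?B)" using ord p_pos by (simp add: order_def card_ge_0_finite)
  define y where "y i = U #>\<^bsub>F\<^esub> x i" for i
  have y: "y \<in> {1..g} \<rightarrow> carrier ?B" using x_closed by (auto simp: y_def carrier_FactGroup)
  have yq: "y i [^]\<^bsub>?B\<^esub> q = \<one>\<^bsub>?B\<^esub>" if "i \<in> {1..g}" for i
    using that x_closed pow by (simp add: y_def U.FactGroup_pow U.rcos_eq_iff)
  interpret s: group_hom H ?B "hc_hom g ?B y"
    using hc_hom_is_hom[OF cB y yq q_pos] by unfold_locales
  fix a assume a: "a \<in> kernel F H \<phi>"
  then have ac: "a \<in> carrier F" by (simp add: kernel_def)
  have "U #>\<^bsub>F\<^esub> a = (hc_hom g ?B y \<circ> \<phi>) a"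
  proof (rule hom_unique_finite[OF B.is_group fin ord _ _ _ _ _ ac])
    show "(\<lambda>a. U #>\<^bsub>F\<^esub> a) \<in> hom F ?B" by (rule U.r_coset_hom_Mod)
    show "continuous_map T (discrete_topology (carrier ?B)) (\<lambda>a. U #>\<^bsub>F\<^esub> a)"
      by (rule quotient_hom_continuous[OF U(1,2)])
    show "hc_hom g ?B y \<circ> \<phi> \<in> hom F ?B" using s.homh \<phi>_hom by (auto simp: hom_def)
    show "continuous_map T (discrete_topology (carrier ?B)) (hc_hom g ?B y \<circ> \<phi>)"
      by (rule continuous_map_compose[OF \<phi>_continuous]) auto
    show "U #>\<^bsub>F\<^esub> x i = (hc_hom g ?B y \<circ> \<phi>) (x i)" if "i \<in> {1..g}" for i
      using hc_hom_unit[OF cB y yq that] \<phi>_x[OF that] by (simp flip: y_def)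
  qed
  also have "\<dots> = \<one>\<^bsub>?B\<^esub>" using a s.hom_one by (simp add: kernel_def)
  finally show "a \<in> U" using U.rcos_eq_iff[OF ac] by simp
qed

text \<open>The preimage in F of the q-th powers of F/U is again open and normal, contains the
  derived subgroup, and contains every q-th power, so \<open>kernel_\<phi>_subset\<close> applies to
  it in place of U.\<close>

lemma kernel_\<phi>_powers_mod:
  assumes U: "U \<lhd> F" "openin T U" "derived F (carrier F) \<subseteq> U" and a: "a \<in> kernel F H \<phi>"
  obtains c where "c \<in> carrier F" "U #>\<^bsub>F\<^esub> a = U #>\<^bsub>F\<^esub> (c [^]\<^bsub>F\<^esub> q)"
proof -
  interpret U: normal U F by (rule U(1))
  let ?B = "F Mod U"
  interpret B: comm_group ?B by (rule F.comm_group_Mod_derived_subset[OF U.subgroup_axioms U(3)])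
  let ?J = "(\<lambda>b. b [^]\<^bsub>?B\<^esub> q) ` carrier ?B"
  interpret \<pi>: group_hom F ?B "\<lambda>a. U #>\<^bsub>F\<^esub> a"
    using U.r_coset_hom_Mod by unfold_locales
  have sJ: "subgroup ?J ?B" by (rule B.subgroup_nat_pow_image[OF B.subgroup_self])
  let ?U = "{a \<in> carrier F. U #>\<^bsub>F\<^esub> a \<in> ?J}"
  have nU: "?U \<lhd> F" by (rule \<pi>.normal_vimage[OF B.subgroup_imp_normal[OF sJ]])
  have sub: "U \<subseteq> ?U"
  proof
    fix u assume u: "u \<in> U"
    then have "U #>\<^bsub>F\<^esub> u = \<one>\<^bsub>?B\<^esub>" using U.rcos_eq_iff[of u] by simp
    then show "u \<in> ?U" using u subgroup.one_closed[OF sJ] by simp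
  qed
  have "kernel F H \<phi> \<subseteq> ?U"
  proof (rule kernel_\<phi>_subset[OF nU])
    show "openin T ?U"
      by (rule F.openin_subgroup_supset[OF U.subgroup_axioms U(2) normal_imp_subgroup[OF nU] sub])
    show "derived F (carrier F) \<subseteq> ?U" using U(3) sub by blast
    show "b [^]\<^bsub>F\<^esub> q \<in> ?U" if "b \<in> carrier F" for b
      using that by (auto simp: U.FactGroup_pow[symmetric] carrier_FactGroup)
  qed
  with a obtain b where b: "b \<in> carrier ?B" "U #>\<^bsub>F\<^esub> a = b [^]\<^bsub>?B\<^esub> q" by auto
  then obtain c where "c \<in> carrier F" "b = U #>\<^bsub>F\<^esub> c" by (auto simp: carrier_FactGroup)
  with b that show ?thesis by (simp add: U.FactGroup_pow)
qed

section \<open>The subgroup P and the preimage Q of the relator span in H\<close>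

context
  fixes R P Q
  assumes R: "R \<subseteq> carrier F"
    and P: "subgroup P F" "closedin T P" "derived F (carrier F) \<subseteq> P" "R \<subseteq> P"
  defines "Q \<equiv> {a \<in> carrier F. \<phi> a \<in> generate H (\<phi> ` R)}"
begin

text \<open>Up to the kernel of \<phi>, an element of Q is a word in R, and such words lie in
  P.\<close>

lemma Q_kernel_decomp:
  assumes "a \<in> Q"
  obtains r k where "r \<in> P" "k \<in> kernel F H \<phi>" "a = k \<otimes>\<^bsub>F\<^esub> r"
proof -
  have a: "a \<in> carrier F" "\<phi> a \<in> generate H (\<phi> ` R)" using assms by (auto simp: Q_def)
  then obtain r where r: "r \<in> generate F R" "\<phi> a = \<phi> r" using \<phi>.generate_img[OF R] by auto
  have rP: "r \<in> P" using r(1) F.generate_subgroup_incl[OF P(4,1)] by blast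
  then have rc: "r \<in> carrier F" using subgroup.subset[OF P(1)] by blast
  have "a \<otimes>\<^bsub>F\<^esub> inv\<^bsub>F\<^esub> r \<in> kernel F H \<phi>" using \<phi>.hom_eq_iff_kernel[OF a(1) rc] r(2) by simp
  moreover have "a = (a \<otimes>\<^bsub>F\<^esub> inv\<^bsub>F\<^esub> r) \<otimes>\<^bsub>F\<^esub> r" using a rc by (simp add: F.m_assoc)
  ultimately show ?thesis using that rP by blast
qed

text \<open>By \<open>separate_by_open_normal\<close>, P is the intersection of the open normal
  subgroups above it, so the inclusion may be tested in finite abelian p-quotients of F.\<close>

lemma Q_subset_of_open:
  assumes "\<And>U. U \<lhd> F \<Longrightarrow> openin T U \<Longrightarrow> P \<subseteq> U \<Longrightarrow> Q \<subseteq> U"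
  shows "Q \<subseteq> P"
proof
  fix a assume a: "a \<in> Q"
  then have ac: "a \<in> carrier F" by (simp add: Q_def)
  show "a \<in> P"
  proof (rule ccontr)
    assume "a \<notin> P"
    then obtain U where "U \<lhd> F" "openin T U" "P \<subseteq> U" "a \<notin> U"
      using separate_by_open_normal[OF P(1-3) ac] by metis
    then show False using assms a by blast
  qed
qed

text \<open>An isomorphism of F/P with C puts all q-th powers into P and hence into every U above
  it; then U also contains the kernel of \<phi>, the part of Q not accounted for by P.\<close>

lemma Q_subset_of_iso_P:
  assumes "F Mod P \<cong> C"
  shows "Q \<subseteq> P"
proof (rule Q_subset_of_open)
  interpret P: normal P F by (rule F.normal_of_derived_subset[OF P(1,3)])
  fix U assume U: "U \<lhd> F" "openin T U" "P \<subseteq> U"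
  have "kernel F H \<phi> \<subseteq> U"
  proof (rule kernel_\<phi>_subset[OF U(1,2)])
    show "derived F (carrier F) \<subseteq> U" using P(3) U(3) by blast
    show "a [^]\<^bsub>F\<^esub> q \<in> U" if "a \<in> carrier F" for a
      using P.nat_pow_mem_of_Mod_iso[OF C.is_group assms exponent_C' that] U(3) by blast
  qed
  then show "Q \<subseteq> U"
    using Q_kernel_decomp U(3) subgroup.m_closed[OF normal_imp_subgroup[OF U(1)]]
    by (metis subsetD subsetI)
qed

lemma generate_normal_H: "generate H (\<phi> ` R) \<lhd> H"
  using R by (intro H.subgroup_imp_normal H.generate_is_subgroup) auto

lemma Q_normal: "Q \<lhd> F"
  unfolding Q_def by (rule \<phi>.normal_vimage[OF generate_normal_H])

text \<open>Nakayama's lemma for the finite abelian p-groups \<open>F/U\<close>.\<close>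

lemma Q_subset_of_iso_Q:
  assumes "F Mod Q \<cong> C"
  shows "Q \<subseteq> P"
proof (rule Q_subset_of_open)
  interpret Q: normal Q F by (rule Q_normal)
  fix U assume U: "U \<lhd> F" "openin T U" "P \<subseteq> U"
  have dU: "derived F (carrier F) \<subseteq> U" using P(3) U(3) by blast
  interpret U: normal U F by (rule U(1))
  let ?B = "F Mod U"
  interpret B: comm_group ?B by (rule F.comm_group_Mod_derived_subset[OF U.subgroup_axioms dU])
  \<comment> \<open>In F/U the factor from P disappears, and the factor from the kernel of \<phi>
    becomes a q-th power.\<close>
  have Qpow: "\<exists>c\<in>carrier ?B. U #>\<^bsub>F\<^esub> a = c [^]\<^bsub>?B\<^esub> q" if a: "a \<in> Q" for a
  proof -
    obtain r k where rk: "r \<in> P" "k \<in> kernel F H \<phi>" "a = k \<otimes>\<^bsub>F\<^esub> r" using Q_kernel_decomp[OF a] .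
    then have rU: "r \<in> U" and kc: "k \<in> carrier F" using U(3) by (auto simp: kernel_def)
    have "U #>\<^bsub>F\<^esub> a = (U #>\<^bsub>F\<^esub> k) \<otimes>\<^bsub>?B\<^esub> (U #>\<^bsub>F\<^esub> r)" using rU kc rk by (simp add: U.rcos_sum)
    also have "U #>\<^bsub>F\<^esub> r = \<one>\<^bsub>?B\<^esub>" using rU U.rcos_eq_iff[of r] by simp
    finally have "U #>\<^bsub>F\<^esub> a = U #>\<^bsub>F\<^esub> k" using kc B.r_one[of "U #>\<^bsub>F\<^esub> k"] by (auto simp: carrier_FactGroup)
    moreover obtain c where c: "c \<in> carrier F" "U #>\<^bsub>F\<^esub> k = U #>\<^bsub>F\<^esub> (c [^]\<^bsub>F\<^esub> q)"
      using kernel_\<phi>_powers_mod[OF U(1,2) dU rk(2)] .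
    ultimately show ?thesis
      by (intro bexI[of _ "U #>\<^bsub>F\<^esub> c"]) (auto simp: U.FactGroup_pow carrier_FactGroup)
  qed
  \<comment> \<open>Since C has exponent dividing p^m, every p^m-th power of F lies in Q, and by
    \<open>Qpow\<close> it becomes a p^(m+1)-th power in F/U. Iterating this up to the order p^k of
    F/U shows that p^m-th powers are trivial there, and so is the image of Q.\<close>
  have one_step: "\<exists>c\<in>carrier ?B. b [^]\<^bsub>?B\<^esub> (p ^ m) = c [^]\<^bsub>?B\<^esub> (p ^ m * p)" if b: "b \<in> carrier ?B" for b
  proof -
    obtain a where a: "a \<in> carrier F" "b = U #>\<^bsub>F\<^esub> a" using b by (auto simp: carrier_FactGroup)
    have "a [^]\<^bsub>F\<^esub> (p ^ m) \<in> Q" by (rule Q.nat_pow_mem_of_Mod_iso[OF C.is_group assms exponent_C a(1)])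
    from Qpow[OF this] show ?thesis using a by (simp add: U.FactGroup_pow q_eq mult.commute)
  qed
  have iter: "\<exists>c\<in>carrier ?B. b [^]\<^bsub>?B\<^esub> (p ^ m) = c [^]\<^bsub>?B\<^esub> (p ^ m * p ^ j)" if b: "b \<in> carrier ?B" for b j
  proof (induction j)
    case 0 then show ?case using b by auto
  next
    case (Suc j)
    then obtain c where c: "c \<in> carrier ?B" "b [^]\<^bsub>?B\<^esub> (p ^ m) = c [^]\<^bsub>?B\<^esub> (p ^ m * p ^ j)" by blast
    obtain d where d: "d \<in> carrier ?B" "c [^]\<^bsub>?B\<^esub> (p ^ m) = d [^]\<^bsub>?B\<^esub> (p ^ m * p)" using one_step[OF c(1)] by blast
    have "b [^]\<^bsub>?B\<^esub> (p ^ m) = (c [^]\<^bsub>?B\<^esub> (p ^ m)) [^]\<^bsub>?B\<^esub> (p ^ j)" using c by (simp add: B.nat_pow_pow)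
    also have "\<dots> = d [^]\<^bsub>?B\<^esub> (p ^ m * p ^ Suc j)" using d by (simp add: B.nat_pow_pow mult.assoc)
    finally show ?case using d(1) by blast
  qed
  obtain k where k: "card (rcosets\<^bsub>F\<^esub> U) = p ^ k"
    using pro_p U(1,2) unfolding pro_p_group_def by blast
  then have card_B: "card (carrier ?B) = p ^ k" by (simp add: FactGroup_def)
  have fin: "finite (carrier ?B)" using card_B p_pos by (simp add: card_ge_0_finite)
  have triv: "b [^]\<^bsub>?B\<^esub> (p ^ m) = \<one>\<^bsub>?B\<^esub>" if b: "b \<in> carrier ?B" for b
  proof -
    obtain c where c: "c \<in> carrier ?B" "b [^]\<^bsub>?B\<^esub> (p ^ m) = c [^]\<^bsub>?B\<^esub> (p ^ k * p ^ m)"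
      using iter[OF b, of k] by (auto simp: mult.commute)
    moreover have "c [^]\<^bsub>?B\<^esub> (p ^ k) = \<one>\<^bsub>?B\<^esub>" using B.power_order_eq_one[OF fin c(1)] card_B by simp
    ultimately show ?thesis by (metis B.nat_pow_pow B.nat_pow_one)
  qed
  show "Q \<subseteq> U"
  proof
    fix a assume a: "a \<in> Q"
    then obtain c where c: "c \<in> carrier ?B" "U #>\<^bsub>F\<^esub> a = c [^]\<^bsub>?B\<^esub> (p ^ m * p)"
      using Qpow by (auto simp: q_eq mult.commute)
    have "c [^]\<^bsub>?B\<^esub> (p ^ m * p) = (c [^]\<^bsub>?B\<^esub> (p ^ m)) [^]\<^bsub>?B\<^esub> p" using c(1) by (rule B.nat_pow_pow[symmetric])
    also have "\<dots> = \<one>\<^bsub>?B\<^esub>" unfolding triv[OF c(1)] by (rule B.nat_pow_one)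
    finally have "U #>\<^bsub>F\<^esub> a = \<one>\<^bsub>?B\<^esub>" using c(2) by (rule trans[rotated])
    moreover have "a \<in> carrier F" using a by (rule Q.mem_carrier)
    ultimately show "a \<in> U" using U.rcos_eq_iff[of a] unfolding one_FactGroup by blast
  qed
qed

text \<open>P and Q can differ in general, since Q always contains the kernel of \<phi>. But as soon
  as one of the two quotients is isomorphic to C, the inclusion of Q in P holds as well and the
  quotients coincide.\<close>

lemma Mod_iso_iff:
  assumes "P \<subseteq> Q"
  shows "F Mod P \<cong> C \<longleftrightarrow> H Mod generate H (\<phi> ` R) \<cong> C"
proof -
  have iso: "F Mod Q \<cong> H Mod generate H (\<phi> ` R)"
    unfolding Q_def by (rule \<phi>.Mod_vimage_iso[OF \<phi>_surj generate_normal_H])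
  interpret FQ: group "F Mod Q" by (rule normal.factorgroup_is_group[OF Q_normal])
  have "F Mod Q \<cong> C \<longleftrightarrow> H Mod generate H (\<phi> ` R) \<cong> C"
    using iso_trans[OF iso, of C] iso_trans[OF FQ.iso_sym[OF iso], of C] by (rule iffI[rotated])
  moreover have "F Mod P \<cong> C \<longleftrightarrow> F Mod Q \<cong> C"
  proof
    show "F Mod Q \<cong> C" if "F Mod P \<cong> C" using that equalityI[OF assms Q_subset_of_iso_P[OF that]] by simp
    show "F Mod P \<cong> C" if "F Mod Q \<cong> C" using that equalityI[OF assms Q_subset_of_iso_Q[OF that]] by simp
  qed
  ultimately show ?thesis by simp
qed

end

end

subsection \<open>The presented abelianization as a quotient of F\<close>

context topgroup
begin

lemma closed_normal_closure_normal:
  assumes "R \<subseteq> carrier F"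
  shows "closed_normal_closure F T R \<lhd> F"
proof -
  let ?\<N> = "{N. N \<lhd> F \<and> closedin T N \<and> R \<subseteq> N}"
  have "carrier F \<in> ?\<N>" using assms normal_self closedin_topspace[of T] by (simp add: topspace_eq)
  then have "subgroup (\<Inter>?\<N>) F" by (intro subgroups_Inter) (auto intro: normal_imp_subgroup)
  moreover have "a \<otimes> h \<otimes> inv a \<in> \<Inter>?\<N>" if "a \<in> carrier F" "h \<in> \<Inter>?\<N>" for a h
    using that by (auto simp: normal_inv_iff)
  ultimately show ?thesis unfolding closed_normal_closure_def normal_inv_iff by blast
qed

lemma closed_normal_closure_incl: "R \<subseteq> closed_normal_closure F T R"
  by (auto simp: closed_normal_closure_def)

lemma closed_normal_closure_minimal:
  "N \<lhd> F \<Longrightarrow> closedin T N \<Longrightarrow> R \<subseteq> N \<Longrightarrow> closed_normal_closure F T R \<subseteq> N"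
  by (auto simp: closed_normal_closure_def)

text \<open>The two successive quotients in the definition collapse into one, with P the closure of
  the product of N and the derived subgroup. Minimality of P is recorded because it later places P
  inside the preimage Q.\<close>

lemma presented_abelianization_iso:
  assumes R: "R \<subseteq> carrier F"
  obtains P where "subgroup P F" "closedin T P" "derived F (carrier F) \<subseteq> P" "R \<subseteq> P"
    "\<And>N. N \<lhd> F \<Longrightarrow> closedin T N \<Longrightarrow> R \<subseteq> N \<Longrightarrow> derived F (carrier F) \<subseteq> N \<Longrightarrow> P \<subseteq> N"
    "F Mod P \<cong> presented_abelianization F T R"
proof -
  define N where "N = closed_normal_closure F T R"
  interpret N: normal N F unfolding N_def by (rule closed_normal_closure_normal[OF R])
  interpret second_isomorphism_grp N F "derived F (carrier F)"
    by (intro second_isomorphism_grp.intro second_isomorphism_grp_axioms.intro N.normal_axioms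
        derived_is_subgroup[OF subset_refl])
  define P0 where "P0 = N <#> derived F (carrier F)"
  have P0: "subgroup P0 F" "N \<subseteq> P0" "derived F (carrier F) \<subseteq> P0"
    unfolding P0_def by (rule normal_set_mult_subgroup H_contained_in_set_mult S_contained_in_set_mult)+
  define P where "P = T closure_of P0"
  have sub: "P0 \<subseteq> P" unfolding P_def
    using subgroup.subset[OF P0(1)] by (intro closure_of_subset) (simp add: topspace_eq)
  have sP: "subgroup P F" unfolding P_def by (rule subgroup_closure_of[OF P0(1)])
  have cP: "closedin T P" by (simp add: P_def)
  have dP: "derived F (carrier F) \<subseteq> P" and NP: "N \<subseteq> P" using P0 sub by auto
  interpret P: normal P F by (rule normal_of_derived_subset[OF sP dP])
  let ?\<pi> = "\<lambda>a. N #> a" and ?FN = "F Mod N" and ?TN = "quotient_topology F T N"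
  interpret FN: group ?FN by (rule N.factorgroup_is_group)
  interpret \<pi>: group_hom F ?FN ?\<pi> using N.r_coset_hom_Mod by unfold_locales
  have surj: "?\<pi> ` carrier F = carrier ?FN" by (simp add: carrier_FactGroup)
  \<comment> \<open>Subgroups above N are unions of N-cosets, so they can be recovered from their
    images in F/N.\<close>
  have mem: "?\<pi> a \<in> ?\<pi> ` S \<longleftrightarrow> a \<in> S" if "subgroup S F" "N \<subseteq> S" "a \<in> carrier F" for S a
  proof
    assume "?\<pi> a \<in> ?\<pi> ` S"
    then obtain s where s: "s \<in> S" "?\<pi> a = ?\<pi> s" by blast
    have "a \<in> N #> a" using that(3) by (rule rcos_self) (rule N.subgroup_axioms)
    then obtain n where "n \<in> N" "a = n \<otimes> s" using s(2) by (auto simp: r_coset_def)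
    then show "a \<in> S" using that s subgroup.m_closed[OF that(1)] by blast
  qed simp
  have topN: "topspace ?TN = carrier ?FN"
  proof
    show "topspace ?TN \<subseteq> carrier ?FN"
      using openin_quotient_topology[of F T N] openin_topspace[of ?TN] by blast
    have "{a \<in> topspace T. N #> a \<in> carrier ?FN} = topspace T" by (auto simp: carrier_FactGroup topspace_eq)
    then have "openin ?TN (carrier ?FN)" unfolding openin_quotient_topology by simp
    then show "carrier ?FN \<subseteq> topspace ?TN" by (rule openin_subset)
  qed
  have \<pi>_cont: "continuous_map T ?TN ?\<pi>"
    unfolding continuous_map_def
    by (auto simp: topN openin_quotient_topology carrier_FactGroup topspace_eq)
  have derN: "derived ?FN (carrier ?FN) = ?\<pi> ` derived F (carrier F)"
    using \<pi>.derived_img[OF subset_refl] surj by simp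
  \<comment> \<open>The image of P is closed because the preimage of its complement is the
    complement of P. Conversely, continuity sends P into the closure of the image of P0, and that
    image lies in the derived subgroup of F/N.\<close>
  have "?TN closure_of derived ?FN (carrier ?FN) = ?\<pi> ` P"
  proof
    show "?TN closure_of derived ?FN (carrier ?FN) \<subseteq> ?\<pi> ` P"
    proof (rule closure_of_minimal)
      show "derived ?FN (carrier ?FN) \<subseteq> ?\<pi> ` P" unfolding derN using dP by blast
      have "{a \<in> topspace T. N #> a \<in> carrier ?FN - ?\<pi> ` P} = topspace T - P"
        using mem[OF sP NP] by (auto simp: topspace_eq carrier_FactGroup)
      then have "openin ?TN (carrier ?FN - ?\<pi> ` P)"
        unfolding openin_quotient_topology using cP by (simp add: closedin_def)
      moreover have "?\<pi> ` P \<subseteq> carrier ?FN" by (auto simp: carrier_FactGroup)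
      ultimately show "closedin ?TN (?\<pi> ` P)" by (simp add: closedin_def topN)
    qed
    have "?\<pi> ` P0 \<subseteq> derived ?FN (carrier ?FN)"
    proof
      fix X assume "X \<in> ?\<pi> ` P0"
      then obtain n d where nd: "n \<in> N" "d \<in> derived F (carrier F)" "X = ?\<pi> (n \<otimes> d)"
        by (auto simp: P0_def set_mult_def)
      have dc: "d \<in> carrier F" using nd(2) derived_in_carrier[OF subset_refl] by blast
      then have "n \<otimes> d \<in> N #> d" using nd(1) by (auto simp: r_coset_def)
      then have "N #> d = N #> (n \<otimes> d)" by (rule repr_independence) (use dc N.subgroup_axioms in auto)
      then show "X \<in> derived ?FN (carrier ?FN)" unfolding derN using nd by auto
    qed
    then have "?TN closure_of (?\<pi> ` P0) \<subseteq> ?TN closure_of derived ?FN (carrier ?FN)"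
      by (rule closure_of_mono)
    moreover have "?\<pi> ` P \<subseteq> ?TN closure_of (?\<pi> ` P0)"
      unfolding P_def by (rule continuous_map_image_closure_subset[OF \<pi>_cont])
    ultimately show "?\<pi> ` P \<subseteq> ?TN closure_of derived ?FN (carrier ?FN)" by blast
  qed
  then have eq: "presented_abelianization F T R = ?FN Mod (?\<pi> ` P)"
    by (simp add: presented_abelianization_def abelianization_def Let_def N_def)
  have "?\<pi> ` P \<lhd> ?FN" by (rule P.surj_hom_normal_subgroup[OF \<pi>.group_hom_axioms surj])
  from \<pi>.Mod_vimage_iso[OF surj this] have "F Mod {a \<in> carrier F. ?\<pi> a \<in> ?\<pi> ` P} \<cong> ?FN Mod (?\<pi> ` P)" .
  moreover have "{a \<in> carrier F. ?\<pi> a \<in> ?\<pi> ` P} = P" using mem[OF sP NP] P.subset by blast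
  ultimately have iso: "F Mod P \<cong> presented_abelianization F T R" unfolding eq by simp
  have RP: "R \<subseteq> P" using closed_normal_closure_incl[of R] NP by (simp add: N_def)
  have min: "P \<subseteq> M" if M: "M \<lhd> F" "closedin T M" "R \<subseteq> M" "derived F (carrier F) \<subseteq> M" for M
    unfolding P_def
  proof (rule closure_of_minimal[OF _ M(2)])
    have "N \<subseteq> M" unfolding N_def by (rule closed_normal_closure_minimal[OF M(1-3)])
    with M(4) show "P0 \<subseteq> M" unfolding P0_def set_mult_def
      using subgroup.m_closed[OF normal_imp_subgroup[OF M(1)]] by blast
  qed
  show thesis by (rule that[OF sP cP dP RP min iso])
qed

end

subsection \<open>The Frattini subgroup and the involution\<close>

context homocyclic_quotient
begin

lemma derived_subset_vimage:
  assumes "subgroup J H"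
  shows "derived F (carrier F) \<subseteq> {a \<in> carrier F. \<phi> a \<in> J}"
proof
  fix a assume a: "a \<in> derived F (carrier F)"
  then have "\<phi> a \<in> derived H (carrier H)" using \<phi>.derived_img[OF subset_refl] \<phi>_surj by auto
  then have "\<phi> a = \<one>\<^bsub>H\<^esub>" using H.derived_eq_singleton[of "carrier H"] by auto
  then show "a \<in> {a \<in> carrier F. \<phi> a \<in> J}"
    using a F.derived_in_carrier[OF subset_refl] subgroup.one_closed[OF assms] by auto
qed

text \<open>The preimage under \<phi> of the span of the relators is closed and normal and contains
  both R and the derived subgroup; minimality of P then gives the inclusion that
  \<open>Mod_iso_iff\<close> requires.\<close>

lemma presented_abelianization_iff:
  assumes R: "R \<subseteq> carrier F"
  shows "presented_abelianization F T R \<cong> C \<longleftrightarrow> H Mod generate H (\<phi> ` R) \<cong> C"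
proof -
  obtain P where P: "subgroup P F" "closedin T P" "derived F (carrier F) \<subseteq> P" "R \<subseteq> P"
    and min: "\<And>N. N \<lhd> F \<Longrightarrow> closedin T N \<Longrightarrow> R \<subseteq> N \<Longrightarrow> derived F (carrier F) \<subseteq> N \<Longrightarrow> P \<subseteq> N"
    and iso: "F Mod P \<cong> presented_abelianization F T R"
    using F.presented_abelianization_iso[OF R] by metis
  let ?J = "generate H (\<phi> ` R)"
  have J: "?J \<lhd> H" by (rule generate_normal_H[OF R P])
  have "P \<subseteq> {a \<in> carrier F. \<phi> a \<in> ?J}"
  proof (rule min)
    show "{a \<in> carrier F. \<phi> a \<in> ?J} \<lhd> F" by (rule \<phi>.normal_vimage[OF J])
    show "closedin T {a \<in> carrier F. \<phi> a \<in> ?J}" by (rule closedin_\<phi>_vimage)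
    show "R \<subseteq> {a \<in> carrier F. \<phi> a \<in> ?J}" using R generate.incl[of _ "\<phi> ` R" H] by auto
    show "derived F (carrier F) \<subseteq> {a \<in> carrier F. \<phi> a \<in> ?J}"
      by (rule derived_subset_vimage[OF normal_imp_subgroup[OF J]])
  qed
  then have "F Mod P \<cong> C \<longleftrightarrow> H Mod ?J \<cong> C" by (rule Mod_iso_iff[OF R P])
  moreover have "F Mod P \<cong> C \<longleftrightarrow> presented_abelianization F T R \<cong> C"
  proof -
    interpret FP: group "F Mod P"
      by (rule normal.factorgroup_is_group[OF F.normal_of_derived_subset[OF P(1,3)]])
    show ?thesis using iso_trans[OF iso, of C] iso_trans[OF FP.iso_sym[OF iso], of C] by (rule iffI[rotated])
  qed
  ultimately show ?thesis by simp
qed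

abbreviation "\<Phi> \<equiv> Frattini p F T"
abbreviation "pH \<equiv> (\<lambda>y. y [^]\<^bsub>H\<^esub> p) ` carrier H"

lemma subgroup_pH: "subgroup pH H"
  by (rule H.subgroup_nat_pow_image[OF H.subgroup_self])

lemma subgroup_Frattini: "subgroup \<Phi> F"
proof -
  interpret D: normal "derived F (carrier F)" F by (rule F.derived_is_normal[OF F.normal_self])
  interpret second_isomorphism_grp "derived F (carrier F)" F
      "generate F ((\<lambda>y. y [^]\<^bsub>F\<^esub> p) ` carrier F)"
    by (intro second_isomorphism_grp.intro second_isomorphism_grp_axioms.intro D.normal_axioms
        F.generate_is_subgroup) auto
  show ?thesis unfolding Frattini_def by (rule F.subgroup_closure_of[OF normal_set_mult_subgroup])
qed

lemma Frattini_carrier: "\<Phi> \<subseteq> carrier F" by (rule subgroup.subset[OF subgroup_Frattini])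

text \<open>The preimage of pH is a closed subgroup with all commutators and p-th powers, so taking
  the closure in the definition of \<open>Frattini\<close> does not leave it. For the other
  inclusion, a p-th power in H lifts to a p-th power in F.\<close>

lemma \<phi>_image_Frattini: "\<phi> ` \<Phi> = pH"
proof
  let ?E = "{a \<in> carrier F. \<phi> a \<in> pH}" and ?G = "generate F ((\<lambda>y. y [^]\<^bsub>F\<^esub> p) ` carrier F)"
  have sE: "subgroup ?E F"
    by (rule normal_imp_subgroup[OF \<phi>.normal_vimage[OF H.subgroup_imp_normal[OF subgroup_pH]]])
  have "?G \<subseteq> ?E" using sE by (intro F.generate_subgroup_incl) (auto simp: \<phi>.hom_nat_pow)
  then have "derived F (carrier F) <#>\<^bsub>F\<^esub> ?G \<subseteq> ?E"
    using derived_subset_vimage[OF subgroup_pH] subgroup.m_closed[OF sE]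
    unfolding set_mult_def by blast
  then have "\<Phi> \<subseteq> ?E" unfolding Frattini_def by (rule closure_of_minimal[OF _ closedin_\<phi>_vimage])
  then show "\<phi> ` \<Phi> \<subseteq> pH" by blast
  show "pH \<subseteq> \<phi> ` \<Phi>"
  proof
    fix h assume "h \<in> pH"
    then obtain k where k: "k \<in> carrier H" "h = k [^]\<^bsub>H\<^esub> p" by auto
    then obtain a where a: "a \<in> carrier F" "k = \<phi> a" using \<phi>_surj by auto
    have "\<one>\<^bsub>F\<^esub> \<otimes>\<^bsub>F\<^esub> a [^]\<^bsub>F\<^esub> p \<in> derived F (carrier F) <#>\<^bsub>F\<^esub> ?G"
      unfolding set_mult_def using a subgroup.one_closed[OF F.derived_is_subgroup[OF subset_refl]]
        generate.incl[of "a [^]\<^bsub>F\<^esub> p" "(\<lambda>y. y [^]\<^bsub>F\<^esub> p) ` carrier F" F] by blast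
    then have "a [^]\<^bsub>F\<^esub> p \<in> derived F (carrier F) <#>\<^bsub>F\<^esub> ?G" using a by simp
    moreover have "derived F (carrier F) <#>\<^bsub>F\<^esub> ?G \<subseteq> \<Phi>" unfolding Frattini_def
    proof (rule closure_of_subset)
      have "?G \<subseteq> carrier F" by (rule F.generate_incl) auto
      then show "derived F (carrier F) <#>\<^bsub>F\<^esub> ?G \<subseteq> topspace T" unfolding F.topspace_eq
        using F.derived_in_carrier[OF subset_refl] by (intro F.setmult_subset_G)
    qed
    ultimately have "a [^]\<^bsub>F\<^esub> p \<in> \<Phi>" by blast
    moreover have "h = \<phi> (a [^]\<^bsub>F\<^esub> p)" using k a by (simp add: \<phi>.hom_nat_pow)
    ultimately show "h \<in> \<phi> ` \<Phi>" by blast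
  qed
qed

text \<open>Inversion is a homomorphism on the abelian group H, so both sides are continuous
  homomorphisms from F to H, and they agree on the free generators.\<close>

lemma \<phi>_involution:
  assumes \<sigma>: "\<sigma> \<in> iso F F" "continuous_map T T \<sigma>" "\<And>i. i \<in> {1..g} \<Longrightarrow> \<sigma> (x i) = inv\<^bsub>F\<^esub> (x i)"
    and a: "a \<in> carrier F"
  shows "\<phi> (\<sigma> a) = inv\<^bsub>H\<^esub> (\<phi> a)"
proof -
  have \<sigma>h: "\<sigma> \<in> hom F F" using \<sigma>(1) by (simp add: iso_def)
  have "(\<phi> \<circ> \<sigma>) a = ((\<lambda>h. inv\<^bsub>H\<^esub> h) \<circ> \<phi>) a"
  proof (rule hom_unique[OF H_pro_p _ _ _ _ _ a])
    show "\<phi> \<circ> \<sigma> \<in> hom F H" using \<sigma>h by (auto simp: hom_def Pi_iff)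
    show "continuous_map T (discrete_topology (carrier H)) (\<phi> \<circ> \<sigma>)"
      by (rule continuous_map_compose[OF \<sigma>(2) \<phi>_continuous])
    show "(\<lambda>h. inv\<^bsub>H\<^esub> h) \<circ> \<phi> \<in> hom F H" by (auto simp: hom_def H.inv_mult)
    show "continuous_map T (discrete_topology (carrier H)) ((\<lambda>h. inv\<^bsub>H\<^esub> h) \<circ> \<phi>)"
      by (rule continuous_map_compose[OF \<phi>_continuous]) auto
    show "(\<phi> \<circ> \<sigma>) (x i) = ((\<lambda>h. inv\<^bsub>H\<^esub> h) \<circ> \<phi>) (x i)" if "i \<in> {1..g}" for i
      using that \<sigma>(3) x_closed by simp
  qed
  then show ?thesis by simp
qed

end

text \<open>Invertibility of -2 modulo q in explicit form: if q = 2k + 1 and w is the inverse of v,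
  then w^(2k) is the inverse of w, so the k-th power of the square of w is v.\<close>

lemma (in comm_group) generate_inverse_squares:
  fixes q :: nat
  assumes "odd q" and v: "v \<in> I \<rightarrow> carrier G" and exp: "\<And>a. a \<in> carrier G \<Longrightarrow> a [^] q = \<one>"
  shows "generate G ((\<lambda>i. inv (v i) \<otimes> inv (v i)) ` I) = generate G (v ` I)" (is "generate G ?S = _")
proof
  have vI: "v ` I \<subseteq> carrier G" and S: "?S \<subseteq> carrier G" using v by auto
  have sv: "subgroup (generate G (v ` I)) G" and sS: "subgroup (generate G ?S) G"
    using vI S by (auto intro: generate_is_subgroup)
  have "inv (v i) \<otimes> inv (v i) \<in> generate G (v ` I)" if "i \<in> I" for i
    using that by (intro generate.eng generate.inv) auto
  then show "generate G ?S \<subseteq> generate G (v ` I)" by (intro generate_subgroup_incl[OF _ sv]) auto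
  obtain k where k: "q = 2 * k + 1" using \<open>odd q\<close> by (auto elim: oddE)
  have "v i \<in> generate G ?S" if "i \<in> I" for i
  proof -
    let ?w = "inv (v i)"
    have vi: "v i \<in> carrier G" using v that by auto
    have "(?w \<otimes> ?w) [^] k = ?w [^] (2 * k)"
      using vi nat_pow_mult[of ?w k k] by (simp add: nat_pow_distrib mult_2)
    moreover have "?w [^] (2 * k) \<otimes> ?w = \<one>" using exp[of ?w] vi by (simp add: k)
    then have "inv ?w = ?w [^] (2 * k)" using vi by (intro inv_equality) auto
    ultimately have "v i = (?w \<otimes> ?w) [^] k" using vi by simp
    moreover have "(?w \<otimes> ?w) [^] k \<in> generate G ?S"
      using that by (intro subgroup_nat_pow_closed[OF sS] generate.incl) auto
    ultimately show ?thesis by simp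
  qed
  then show "generate G (v ` I) \<subseteq> generate G ?S" by (intro generate_subgroup_incl[OF _ sS]) auto
qed

subsection \<open>Measuring the fibres\<close>

lemma sets_borel_sigma: "sets (borel_sigma X) = sigma_sets (topspace X) {U. openin X U}"
  unfolding borel_sigma_def by (rule sets_measure_of) (auto dest: openin_subset)

lemma openin_sets_borel_sigma: "openin X U \<Longrightarrow> U \<in> sets (borel_sigma X)"
  unfolding sets_borel_sigma by (auto intro: sigma_sets.Basic)

lemma continuous_map_measurable_borel_sigma:
  assumes "continuous_map X Y f" and "sets M = sets (borel_sigma X)"
  shows "f \<in> measurable M (borel_sigma Y)"
proof -
  have sp: "space M = topspace X"
    using sets_eq_imp_space_eq[OF assms(2)] by (simp add: borel_sigma_def space_measure_of_conv)
  show ?thesis unfolding borel_sigma_def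
  proof (rule measurable_measure_of)
    show "{U. openin Y U} \<subseteq> Pow (topspace Y)" by (auto dest: openin_subset)
    show "f \<in> space M \<rightarrow> topspace Y" using assms(1) sp by (auto simp: continuous_map_def)
    fix U assume "U \<in> {U. openin Y U}"
    then have "openin X {a \<in> topspace X. f a \<in> U}" using assms(1) by (auto simp: continuous_map_def)
    moreover have "{a \<in> topspace X. f a \<in> U} = f -` U \<inter> space M" using sp by auto
    ultimately show "f -` U \<inter> space M \<in> sets M" using openin_sets_borel_sigma assms(2) by metis
  qed
qed

context homocyclic_quotient
begin

text \<open>Serves twice: S is the Frattini subgroup on the side of the Haar measure and the relator
  set on the side of the push-forward. The set is a union of boxes, one for each w in W, and a box
  is open because there are finitely many coordinates.\<close>

lemma openin_tuple_fibres:
  assumes S: "S \<subseteq> carrier F"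
  shows "openin (product_topology (\<lambda>_. subtopology T S) {1..g})
    {t \<in> {1..g} \<rightarrow>\<^sub>E S. (\<lambda>i\<in>{1..g}. \<phi> (t i)) \<in> W}" (is "openin ?X ?A")
proof -
  have *: "openin ?X (\<Pi>\<^sub>E i\<in>{1..g}. {a \<in> S. \<phi> a = w i})" for w :: "nat \<Rightarrow> nat \<Rightarrow> nat"
  proof -
    have "openin (subtopology T S) {a \<in> S. \<phi> a = w i}" for i
      unfolding openin_subtopology using openin_\<phi>_vimage[of "{w i}"] S
      by (intro exI[of _ "{a \<in> carrier F. \<phi> a \<in> {w i}}"]) auto
    then show ?thesis by (simp add: openin_PiE)
  qed
  have "?A = (\<Union>w\<in>W \<inter> extensional {1..g}. \<Pi>\<^sub>E i\<in>{1..g}. {a \<in> S. \<phi> a = w i})"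
  proof (intro equalityI subsetI)
    fix t assume t: "t \<in> ?A"
    then have "t \<in> (\<Pi>\<^sub>E i\<in>{1..g}. {a \<in> S. \<phi> a = (\<lambda>i\<in>{1..g}. \<phi> (t i)) i})"
      by (auto simp: PiE_iff)
    with t show "t \<in> (\<Union>w\<in>W \<inter> extensional {1..g}. \<Pi>\<^sub>E i\<in>{1..g}. {a \<in> S. \<phi> a = w i})"
      by blast
  next
    fix t assume "t \<in> (\<Union>w\<in>W \<inter> extensional {1..g}. \<Pi>\<^sub>E i\<in>{1..g}. {a \<in> S. \<phi> a = w i})"
    then obtain w where w: "w \<in> W" "w \<in> extensional {1..g}" and t: "t \<in> (\<Pi>\<^sub>E i\<in>{1..g}. {a \<in> S. \<phi> a = w i})"
      by blast
    have "(\<lambda>i\<in>{1..g}. \<phi> (t i)) = w"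
      by (rule extensionalityI[OF restrict_extensional w(2)]) (use t in \<open>auto simp: PiE_iff\<close>)
    then show "t \<in> ?A" using t w(1) by (auto simp: PiE_iff)
  qed
  then show ?thesis using * by auto
qed

text \<open>Membership in \<open>{v}\<close> instead of an equation makes this literally an instance
  of \<open>openin_tuple_fibres\<close>.\<close>

abbreviation "tuple_fibre v \<equiv> {t \<in> {1..g} \<rightarrow>\<^sub>E \<Phi>. (\<lambda>i\<in>{1..g}. \<phi> (t i)) \<in> {v}}"

lemma disjoint_tuple_fibres: "disjoint_family_on tuple_fibre V"
  by (auto simp: disjoint_family_on_def)

section \<open>Uniform distribution of the image tuples under Haar measure\<close>

context
  fixes M
  assumes Haar: "normalized_Haar_measure (Frattini_power p g F T) (Frattini_power_topology p g F T) M"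
begin

lemma prob_M: "prob_space M" and space_M: "space M = {1..g} \<rightarrow>\<^sub>E \<Phi>"
  and sets_M: "sets M = sets (borel_sigma (Frattini_power_topology p g F T))"
  using Haar by (auto simp: normalized_Haar_measure_def Frattini_power_def)

interpretation M: prob_space M by (rule prob_M)

lemma tuple_fibre_sets: "tuple_fibre v \<in> sets M"
  unfolding sets_M Frattini_power_topology_def
  by (rule openin_sets_borel_sigma[OF openin_tuple_fibres[OF Frattini_carrier]])

text \<open>As \<phi> maps the Frattini subgroup onto pH, v lifts entrywise to a tuple t, and left
  translation by t carries the fibre over the identity onto the fibre over v.\<close>

lemma tuple_fibre_measure_eq:
  assumes v: "v \<in> {1..g} \<rightarrow>\<^sub>E pH"
  shows "measure M (tuple_fibre v) = measure M (tuple_fibre (\<lambda>i\<in>{1..g}. \<one>\<^bsub>H\<^esub>))"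
proof -
  let ?G = "Frattini_power p g F T" and ?o = "\<lambda>i\<in>{1..g}. \<one>\<^bsub>H\<^esub>"
  define t where "t = (\<lambda>i\<in>{1..g}. inv_into \<Phi> \<phi> (v i))"
  have "v i \<in> \<phi> ` \<Phi>" if "i \<in> {1..g}" for i
    unfolding \<phi>_image_Frattini using PiE_mem[OF v that] .
  then have t: "t \<in> {1..g} \<rightarrow>\<^sub>E \<Phi>" "\<And>i. i \<in> {1..g} \<Longrightarrow> \<phi> (t i) = v i"
    by (auto simp: t_def inv_into_into f_inv_into_f)
  have tc: "t i \<in> carrier F" if "i \<in> {1..g}" for i using t(1) that Frattini_carrier by auto
  have "t <#\<^bsub>?G\<^esub> tuple_fibre ?o = tuple_fibre v"
  proof (intro equalityI subsetI)
    fix u assume "u \<in> t <#\<^bsub>?G\<^esub> tuple_fibre ?o"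
    then obtain w where w: "w \<in> {1..g} \<rightarrow>\<^sub>E \<Phi>" "(\<lambda>i\<in>{1..g}. \<phi> (w i)) = ?o"
      and u: "u = (\<lambda>i\<in>{1..g}. t i \<otimes>\<^bsub>F\<^esub> w i)"
      by (auto simp: l_coset_def Frattini_power_def)
    have w1: "\<phi> (w i) = \<one>\<^bsub>H\<^esub>" if "i \<in> {1..g}" for i using fun_cong[OF w(2), of i] that by simp
    have wc: "w i \<in> carrier F" if "i \<in> {1..g}" for i using w(1) that Frattini_carrier by auto
    have "u \<in> {1..g} \<rightarrow>\<^sub>E \<Phi>"
      using u t(1) w(1) subgroup.m_closed[OF subgroup_Frattini] by (auto simp: PiE_iff)
    moreover have "\<phi> (u i) = v i" if "i \<in> {1..g}" for i
    proof -
      have "v i \<in> carrier H" using \<phi>.hom_closed[OF tc[OF that]] t(2)[OF that] by simp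
      then show ?thesis using that u tc[OF that] wc[OF that] w1[OF that] t(2)[OF that] by simp
    qed
    then have "(\<lambda>i\<in>{1..g}. \<phi> (u i)) = v"
      by (intro extensionalityI[OF restrict_extensional, of v]) (use v in \<open>auto simp: PiE_iff\<close>)
    ultimately show "u \<in> tuple_fibre v" by simp
  next
    fix u assume u: "u \<in> tuple_fibre v"
    then have uv: "\<phi> (u i) = v i" if "i \<in> {1..g}" for i using that fun_cong[of "\<lambda>i\<in>{1..g}. \<phi> (u i)" v i] by auto
    have uc: "u i \<in> \<Phi>" "u i \<in> carrier F" if "i \<in> {1..g}" for i using u that Frattini_carrier by auto
    define w where "w = (\<lambda>i\<in>{1..g}. inv\<^bsub>F\<^esub> (t i) \<otimes>\<^bsub>F\<^esub> u i)"
    have "w \<in> {1..g} \<rightarrow>\<^sub>E \<Phi>"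
      using t(1) uc subgroup.m_closed[OF subgroup_Frattini] subgroup.m_inv_closed[OF subgroup_Frattini]
      by (auto simp: w_def PiE_iff)
    moreover have "\<phi> (w i) = \<one>\<^bsub>H\<^esub>" if "i \<in> {1..g}" for i
    proof -
      have "v i \<in> carrier H" using \<phi>.hom_closed[OF tc[OF that]] t(2)[OF that] by simp
      then show ?thesis using that uc[OF that] tc[OF that] uv[OF that] t(2)[OF that] by (simp add: w_def)
    qed
    then have "(\<lambda>i\<in>{1..g}. \<phi> (w i)) = ?o" by (auto simp: fun_eq_iff)
    moreover have "u = t \<otimes>\<^bsub>?G\<^esub> w"
    proof
      fix i
      show "u i = (t \<otimes>\<^bsub>?G\<^esub> w) i"
      proof (cases "i \<in> {1..g}")
        case True
        then show ?thesis using uc[OF True] tc[OF True]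
          by (simp add: Frattini_power_def w_def flip: F.m_assoc)
      next
        case False
        then show ?thesis using u by (auto simp: Frattini_power_def PiE_iff extensional_def)
      qed
    qed
    ultimately show "u \<in> t <#\<^bsub>?G\<^esub> tuple_fibre ?o" unfolding l_coset_def by blast
  qed
  moreover have "emeasure M (t <#\<^bsub>?G\<^esub> tuple_fibre ?o) = emeasure M (tuple_fibre ?o)"
    using Haar t(1) tuple_fibre_sets unfolding normalized_Haar_measure_def
    by (auto simp: Frattini_power_def)
  ultimately show ?thesis by (simp add: measure_def)
qed

lemma tuple_fibre_measure:
  assumes "v \<in> {1..g} \<rightarrow>\<^sub>E pH"
  shows "measure M (tuple_fibre v) = 1 / real (card pH ^ g)"
proof -
  let ?V = "{1..g} \<rightarrow>\<^sub>E pH" and ?o = "\<lambda>i\<in>{1..g}. \<one>\<^bsub>H\<^esub>"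
  have fin: "finite ?V" using finite_H by (intro finite_PiE) auto
  have "(\<lambda>i\<in>{1..g}. \<phi> (t i)) \<in> ?V" if "t \<in> {1..g} \<rightarrow>\<^sub>E \<Phi>" for t
    unfolding \<phi>_image_Frattini[symmetric] using that by auto
  then have "space M = (\<Union>v\<in>?V. tuple_fibre v)" unfolding space_M by blast
  then have "1 = measure M (\<Union>v\<in>?V. tuple_fibre v)" using M.prob_space by simp
  also have "\<dots> = (\<Sum>v\<in>?V. measure M (tuple_fibre v))"
    by (rule M.finite_measure_finite_Union[OF fin _ disjoint_tuple_fibres]) (use tuple_fibre_sets in auto)
  also have "\<dots> = (\<Sum>v\<in>?V. measure M (tuple_fibre ?o))"
    by (intro sum.cong refl tuple_fibre_measure_eq)
  also have "\<dots> = real (card pH ^ g) * measure M (tuple_fibre ?o)" by (simp add: card_PiE)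
  finally have "real (card pH ^ g) * measure M (tuple_fibre ?o) = 1" ..
  moreover have "b = 1 / a" if "a * b = 1" for a b :: real
    using that by (cases "a = 0") (auto simp: field_simps)
  ultimately have "measure M (tuple_fibre ?o) = 1 / real (card pH ^ g)" by blast
  then show ?thesis using tuple_fibre_measure_eq[OF assms] by simp
qed

lemma measure_presenting_tuples:
  "measure M {t \<in> {1..g} \<rightarrow>\<^sub>E \<Phi>. (\<lambda>i\<in>{1..g}. \<phi> (t i)) \<in> presenting_tuples}
    = real (card presenting_tuples) / real (card pH ^ g)" (is "measure M ?A = _")
proof -
  \<comment> \<open>Only tuples with entries in pH have a fibre of the common positive measure, so
    every presenting tuple must be shown to have its entries there.\<close>
  have sub: "presenting_tuples \<subseteq> {1..g} \<rightarrow>\<^sub>E pH"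
  proof
    fix v assume v: "v \<in> presenting_tuples"
    then have "v \<in> extensional {1..g}" by (simp add: presenting_tuples_def PiE_def)
    then show "v \<in> {1..g} \<rightarrow>\<^sub>E pH" using presenting_tuples_powers[OF v] by (auto simp: PiE_iff)
  qed
  have "finite ({1..g} \<rightarrow>\<^sub>E pH)" using finite_H by (intro finite_PiE) auto
  then have fin: "finite presenting_tuples" using sub finite_subset by blast
  have "?A = (\<Union>v\<in>presenting_tuples. tuple_fibre v)" by auto
  then have "measure M ?A = (\<Sum>v\<in>presenting_tuples. measure M (tuple_fibre v))"
    using M.finite_measure_finite_Union[OF fin _ disjoint_tuple_fibres] tuple_fibre_sets by auto
  also have "\<dots> = (\<Sum>v\<in>presenting_tuples. 1 / real (card pH ^ g))"
    using sub by (intro sum.cong refl tuple_fibre_measure) auto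
  finally show ?thesis by simp
qed

section \<open>Passage from the Frattini tuples to the relators\<close>

context
  fixes \<sigma>
  assumes odd: "odd p" and \<sigma>: "\<sigma> \<in> iso F F" "continuous_map T T \<sigma>"
    "\<forall>i\<in>{1..g}. \<sigma> (x i) = inv\<^bsub>F\<^esub> (x i)"
begin

abbreviation "relator t \<equiv> \<lambda>i\<in>{1..g}. inv\<^bsub>F\<^esub> (t i) \<otimes>\<^bsub>F\<^esub> \<sigma> (t i)"

lemma \<sigma>_closed: "a \<in> carrier F \<Longrightarrow> \<sigma> a \<in> carrier F"
  using \<sigma>(1) by (auto simp: iso_def hom_def)

lemma relator_set_carrier: "relator_set p F T \<sigma> \<subseteq> carrier F"
  using Frattini_carrier \<sigma>_closed by (auto simp: relator_set_def)

lemma relator_closed: "t \<in> {1..g} \<rightarrow>\<^sub>E \<Phi> \<Longrightarrow> relator t \<in> {1..g} \<rightarrow>\<^sub>E relator_set p F T \<sigma>"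
  by (auto simp: relator_set_def)

lemma presented_iff:
  assumes "r \<in> {1..g} \<rightarrow>\<^sub>E relator_set p F T \<sigma>"
  shows "presented_abelianization F T (r ` {1..g}) \<cong> C \<longleftrightarrow> (\<lambda>i\<in>{1..g}. \<phi> (r i)) \<in> presenting_tuples"
proof -
  have R: "r ` {1..g} \<subseteq> carrier F" using assms relator_set_carrier by auto
  have "(\<lambda>i\<in>{1..g}. \<phi> (r i)) ` {1..g} = \<phi> ` r ` {1..g}" by auto
  moreover have "(\<lambda>i\<in>{1..g}. \<phi> (r i)) \<in> {1..g} \<rightarrow>\<^sub>E carrier H" using R by auto
  ultimately show ?thesis using presented_abelianization_iff[OF R] by (simp add: presenting_tuples_def)
qed

lemma relator_presenting_iff:
  assumes t: "t \<in> {1..g} \<rightarrow>\<^sub>E \<Phi>"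
  shows "(\<lambda>i\<in>{1..g}. \<phi> (relator t i)) \<in> presenting_tuples \<longleftrightarrow> (\<lambda>i\<in>{1..g}. \<phi> (t i)) \<in> presenting_tuples"
proof -
  have tc: "t i \<in> carrier F" if "i \<in> {1..g}" for i using t that Frattini_carrier by auto
  have eq: "\<phi> (relator t i) = inv\<^bsub>H\<^esub> (\<phi> (t i)) \<otimes>\<^bsub>H\<^esub> inv\<^bsub>H\<^esub> (\<phi> (t i))" if "i \<in> {1..g}" for i
    using tc[OF that] that \<sigma>_closed[OF tc[OF that]] \<phi>_involution[OF \<sigma>(1,2) _ tc[OF that]] \<sigma>(3) by simp
  have "odd q" using odd by (simp add: q_eq)
  then have "generate H ((\<lambda>i. inv\<^bsub>H\<^esub> (\<phi> (t i)) \<otimes>\<^bsub>H\<^esub> inv\<^bsub>H\<^esub> (\<phi> (t i))) ` {1..g}) =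
      generate H ((\<lambda>i. \<phi> (t i)) ` {1..g})"
    by (rule H.generate_inverse_squares[OF _ _ pow_exponent_homocyclic]) (use tc in auto)
  moreover have "(\<lambda>i\<in>{1..g}. \<phi> (relator t i)) ` {1..g} =
      (\<lambda>i. inv\<^bsub>H\<^esub> (\<phi> (t i)) \<otimes>\<^bsub>H\<^esub> inv\<^bsub>H\<^esub> (\<phi> (t i))) ` {1..g}"
    using eq by (intro image_cong) auto
  moreover have "(\<lambda>i\<in>{1..g}. \<phi> (t i)) ` {1..g} = (\<lambda>i. \<phi> (t i)) ` {1..g}" by auto
  moreover have "(\<lambda>i\<in>{1..g}. \<phi> (relator t i)) \<in> {1..g} \<rightarrow>\<^sub>E carrier H"
    "(\<lambda>i\<in>{1..g}. \<phi> (t i)) \<in> {1..g} \<rightarrow>\<^sub>E carrier H"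
    using tc \<sigma>_closed by auto
  ultimately show ?thesis by (simp only: presenting_tuples_def mem_Collect_eq)
qed

lemma continuous_relator:
  "continuous_map (Frattini_power_topology p g F T)
     (product_topology (\<lambda>_. subtopology T (relator_set p F T \<sigma>)) {1..g}) relator"
  unfolding continuous_map_componentwise
proof (intro conjI ballI)
  let ?X = "Frattini_power_topology p g F T"
  have top: "topspace ?X = {1..g} \<rightarrow>\<^sub>E \<Phi>"
    using Frattini_carrier by (auto simp: Frattini_power_topology_def F.topspace_eq PiE_iff)
  show "relator ` topspace ?X \<subseteq> extensional {1..g}" by auto
  fix i assume i: "i \<in> {1..g}"
  have pr: "continuous_map ?X T (\<lambda>t. t i)"
    using continuous_map_product_projection[OF i, of "\<lambda>_. subtopology T \<Phi>"]
    by (simp add: Frattini_power_topology_def continuous_map_in_subtopology)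
  have "continuous_map ?X T (\<lambda>t. inv\<^bsub>F\<^esub> (t i) \<otimes>\<^bsub>F\<^esub> \<sigma> (t i))"
    using continuous_map_compose[OF pr F.continuous_map_inv] continuous_map_compose[OF pr \<sigma>(2)]
    by (intro F.continuous_map_mult2) (auto simp: comp_def)
  then show "continuous_map ?X (subtopology T (relator_set p F T \<sigma>)) (\<lambda>t. relator t i)"
    using i relator_closed by (auto simp: continuous_map_in_subtopology top relator_set_def)
qed

lemma measure_presented:
  "measure (relator_measure p g F T \<sigma> M)
     {r \<in> {1..g} \<rightarrow>\<^sub>E relator_set p F T \<sigma>. presented_abelianization F T (r ` {1..g}) \<cong> C}
   = real (card presenting_tuples) / real (card pH ^ g)"
proof -
  let ?Y = "product_topology (\<lambda>_. subtopology T (relator_set p F T \<sigma>)) {1..g}"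
  let ?A = "{r \<in> {1..g} \<rightarrow>\<^sub>E relator_set p F T \<sigma>. presented_abelianization F T (r ` {1..g}) \<cong> C}"
  \<comment> \<open>Expressed through \<phi>, the event is an open set of relator tuples, hence
    measurable; its pull-back along \<open>relator\<close> is then described by the images of the t
    i themselves.\<close>
  have A: "?A = {r \<in> {1..g} \<rightarrow>\<^sub>E relator_set p F T \<sigma>. (\<lambda>i\<in>{1..g}. \<phi> (r i)) \<in> presenting_tuples}"
    using presented_iff by blast
  have "?A \<in> sets (borel_sigma ?Y)"
    unfolding A by (rule openin_sets_borel_sigma[OF openin_tuple_fibres[OF relator_set_carrier]])
  moreover have "relator \<in> measurable M (borel_sigma ?Y)"
    by (rule continuous_map_measurable_borel_sigma[OF continuous_relator sets_M])
  ultimately have "measure (relator_measure p g F T \<sigma> M) ?A = measure M (relator -` ?A \<inter> space M)"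
    unfolding relator_measure_def by (subst measure_distr) auto
  also have "relator -` ?A \<inter> space M =
      {t \<in> {1..g} \<rightarrow>\<^sub>E \<Phi>. (\<lambda>i\<in>{1..g}. \<phi> (t i)) \<in> presenting_tuples}"
    unfolding A space_M using relator_closed relator_presenting_iff by blast
  finally show ?thesis using measure_presenting_tuples by simp
qed

end

end

end

theorem theorem2p13:
  fixes p g :: nat
    and F :: "'a monoid" and T :: "'a topology" and x :: "nat \<Rightarrow> 'a" and \<sigma> :: "'a \<Rightarrow> 'a"
    and M :: "(nat \<Rightarrow> 'a) measure"
    and C :: "'c monoid"
  assumes "prime p" and "odd p" and "g \<ge> 1"
    and "free_pro_p_group p F T {1..g} x"
    and "\<sigma> \<in> iso F F" and "continuous_map T T \<sigma>"
    and "\<forall>i\<in>{1..g}. \<sigma> (x i) = inv\<^bsub>F\<^esub> (x i)"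
    and "normalized_Haar_measure (Frattini_power p g F T) (Frattini_power_topology p g F T) M"
    and "comm_group C" and "finite (carrier C)" and "\<exists>k. order C = p ^ k"
    and "min_num_generators C = g"
  shows "measure (relator_measure p g F T \<sigma> M)
           {r \<in> {1..g} \<rightarrow>\<^sub>E relator_set p F T \<sigma>.
              presented_abelianization F T (r ` {1..g}) \<cong> C}
         = 1 / real (card (auto C)) * (1 / real p ^ (g\<^sup>2))
           * (\<Prod>k=1..g. (real p ^ g - real p ^ (g - k))\<^sup>2)"
proof -
  obtain m where m: "order C = p ^ m" using assms(11) by blast
  define q where "q = p ^ Suc m"
  interpret finite_abelian_p_group C p m g q
    by (intro finite_abelian_p_group.intro assms m q_def)
  interpret free_pro_p p g F T x
    by (intro free_pro_p.intro assms)
  have "pro_p_group p H (discrete_topology (carrier H))"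
    by (rule finite_discrete_pro_p_group[OF H.is_group finite_H assms(1), of "Suc m * g"])
       (simp only: order_def card_homocyclic power_mult q_def)
  from universal[OF this, of "hc_unit q g"]
  obtain \<phi> where \<phi>: "\<phi> \<in> hom F H" "continuous_map T (discrete_topology (carrier H)) \<phi>"
    "\<forall>i\<in>{1..g}. \<phi> (x i) = hc_unit q g i"
    using hc_unit_closed[OF q_pos] by blast
  interpret homocyclic_quotient p g F T x C m q \<phi>
    by (intro homocyclic_quotient.intro homocyclic_quotient_axioms.intro free_pro_p_axioms
        finite_abelian_p_group_axioms) (use \<phi> in auto)
  let ?N = "card pH ^ g" and ?GL = "\<Prod>j<g. p ^ g - p ^ j"
  have GL: "real ?GL = (\<Prod>k=1..g. real p ^ g - real p ^ (g - k))"
  proof -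
    have "real ?GL = (\<Prod>j<g. real p ^ g - real p ^ j)"
      unfolding of_nat_prod using p_pos by (intro prod.cong refl) (auto simp: of_nat_diff power_increasing)
    \<comment> \<open>Substitution k = g - j.\<close>
    also have "\<dots> = (\<Prod>k=1..g. real p ^ g - real p ^ (g - k))"
      by (rule prod.reindex_bij_witness[of _ "\<lambda>k. g - k" "\<lambda>j. g - j"]) auto
    finally show ?thesis .
  qed
  have N: "real ?N \<noteq> 0" using finite_H H.one_closed by auto
  have "real (card presenting_tuples) * real (card (auto C)) * real p ^ g\<^sup>2 = real ?N * (real ?GL)\<^sup>2"
    using arg_cong[OF card_presenting_tuples, of real] by (simp only: of_nat_mult of_nat_power)
  \<comment> \<open>The number \<open>?N\<close> of equally likely tuples cancels, and with it the
    dependence on the auxiliary modulus q.\<close>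
  then have "real (card presenting_tuples) / real ?N =
      1 / real (card (auto C)) * (1 / real p ^ g\<^sup>2) * (real ?GL)\<^sup>2"
    using N card_auto_pos p_pos by (simp add: field_simps)
  then show ?thesis
    unfolding measure_presented[OF assms(8,2,5-7)] GL by (simp only: prod_power_distrib)
qed

end
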